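(* Let $M^m$ be a compact PNMC biharmonic submanifold in $\mathbb{S}^n$, and let $A$ be the Weingarten operator associated to $\xi=H/f$. (i) If $|A|^2\leq m$ on $M$, or $|A|^2\geq m$ on $M$, then $M$ is PMC and $|A|^2=m$. (ii) If $|A|$ is constant, then $M$ is PMC and $|A|^2=m$.
   Context: All manifolds are smooth and connected. $\mathbb{S}^n\subset\mathbb{R}^{n+1}$ is the unit Euclidean sphere. Let $\varphi:M^m\to N$ be the inclusion of an $m$-dimensional submanifold in a Riemannian manifold $N$, with mean curvature vector field $H$ (so $mH$ is the trace of the second fundamental form) and mean curvature $f=|H|$. $M$ is biharmonic if $\Delta H+\operatorname{trace}R^N(d\varphi(\cdot),H)d\varphi(\cdot)=0$, where $\Delta V=-\operatorname{trace}\nabla^2V$ is the rough Laplacian on sections of $\varphi^{-1}(TN)$ and $R^N(X,Y)=[\nabla_X,\nabla_Y]-\nabla_{[X,Y]}$. $M$ is PNMC if $f>0$ everywhere and $\nabla^\perp(H/f)=0$, where $\nabla^\perp$ is the normal connection; $M$ is PMC if $\nabla^\perp H=0$. $|A|$ is the Hilbert–Schmidt norm. *)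

theory Defs
  imports "HOL-Analysis.Analysis"
begin

section \<open>Smooth maps and submanifolds of Euclidean spaces\<close>

text \<open>Meant for open \<^term>\<open>U\<close>: \<^term>\<open>f\<close> has continuous iterated directional derivatives up to
  order \<^term>\<open>k\<close>.\<close>

primrec Ck_on :: "nat \<Rightarrow> 'a::real_normed_vector set \<Rightarrow> ('a \<Rightarrow> 'b::real_normed_vector) \<Rightarrow> bool" where
  "Ck_on 0 U f \<longleftrightarrow> continuous_on U f"
| "Ck_on (Suc k) U f \<longleftrightarrow>
     (\<forall>x\<in>U. f differentiable (at x)) \<and> (\<forall>v. Ck_on k U (\<lambda>x. frechet_derivative f (at x) v))"

definition smooth_on :: "'a::real_normed_vector set \<Rightarrow> ('a \<Rightarrow> 'b::real_normed_vector) \<Rightarrow> bool" where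
  "smooth_on U f \<longleftrightarrow> (\<forall>k. Ck_on k U f)"

text \<open>Embedded submanifolds (without boundary) of dimension \<^term>\<open>m\<close>, by slice charts \<^term>\<open>\<Phi>\<close>
  with inverse \<^term>\<open>\<Psi>\<close>. Connectedness is not included.\<close>

definition submanifold :: "nat \<Rightarrow> 'a::euclidean_space set \<Rightarrow> bool" where
  "submanifold m M \<longleftrightarrow>
     (\<forall>p\<in>M. \<exists>U (\<Phi> :: 'a \<Rightarrow> 'a) \<Psi> S.
        open U \<and> p \<in> U \<and> open (\<Phi> ` U) \<and> smooth_on U \<Phi> \<and> smooth_on (\<Phi> ` U) \<Psi> \<and>
        (\<forall>x\<in>U. \<Psi> (\<Phi> x) = x) \<and> subspace S \<and> dim S = m \<and> \<Phi> ` (U \<inter> M) = \<Phi> ` U \<inter> S)"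

definition tangent_space :: "'a::euclidean_space set \<Rightarrow> 'a \<Rightarrow> 'a set" where
  "tangent_space M p =
     {x. \<exists>e>0. \<exists>\<gamma> :: real \<Rightarrow> 'a. smooth_on {-e<..<e} \<gamma> \<and> \<gamma> ` {-e<..<e} \<subseteq> M \<and> \<gamma> 0 = p \<and>
           (\<gamma> has_vector_derivative x) (at 0)}"

text \<open>The derivative of a map defined along \<^term>\<open>M\<close> is taken as a derivative within \<^term>\<open>M\<close>. As a
  linear map on the ambient space it is not unique, but on tangent vectors it is:\<close>

lemma derivative_within_unique_on_tangent_space:
  fixes V :: "'a::euclidean_space \<Rightarrow> 'b::real_normed_vector"
  assumes D: "(V has_derivative D) (at p within M)" and D': "(V has_derivative D') (at p within M)"
    and x: "x \<in> tangent_space M p"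
  shows "D x = D' x"
proof -
  obtain e :: real and \<gamma> where e: "e > 0" and \<gamma>: "\<gamma> ` {-e<..<e} \<subseteq> M" "\<gamma> 0 = p"
    and d: "(\<gamma> has_vector_derivative x) (at 0)"
    using x unfolding tangent_space_def by blast
  have op: "open {-e<..<e}" "0 \<in> {-e<..<e}" using e by auto
  have d0: "(\<gamma> has_derivative (\<lambda>t. t *\<^sub>R x)) (at 0 within {-e<..<e})"
    using d unfolding has_vector_derivative_def by (rule has_derivative_at_withinI)
  have *: "((V \<circ> \<gamma>) has_vector_derivative E x) (at 0)" if E: "(V has_derivative E) (at p within M)" for E
  proof -
    have "(V has_derivative E) (at (\<gamma> 0) within \<gamma> ` {-e<..<e})"
      using E \<gamma> by (metis has_derivative_subset)
    from diff_chain_within[OF d0 this]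
    have "((V \<circ> \<gamma>) has_derivative (\<lambda>t. E (t *\<^sub>R x))) (at 0 within {-e<..<e})"
      by (simp add: o_def)
    moreover have "linear E" using E by (rule has_derivative_linear)
    ultimately show ?thesis
      unfolding has_vector_derivative_def using at_within_open[OF op(2) op(1)]
      by (simp add: linear_cmul)
  qed
  show ?thesis using *[OF D] *[OF D'] by (rule vector_derivative_unique_at)
qed

abbreviation der :: "'a::euclidean_space set \<Rightarrow> ('a \<Rightarrow> 'b::real_normed_vector) \<Rightarrow> 'a \<Rightarrow> 'a \<Rightarrow> 'b" where
  "der M V p \<equiv> frechet_derivative V (at p within M)"


section \<open>Linear algebra\<close>

definition proj :: "'a::euclidean_space set \<Rightarrow> 'a \<Rightarrow> 'a" where
  "proj S v = (THE w. w \<in> S \<and> (\<forall>z\<in>S. orthogonal (v - w) z))"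

definition orthonormal_basis :: "'a::euclidean_space set \<Rightarrow> 'a set \<Rightarrow> bool" where
  "orthonormal_basis S B \<longleftrightarrow> pairwise orthogonal B \<and> (\<forall>b\<in>B. norm b = 1) \<and> span B = S"

definition trace_on :: "'a::euclidean_space set \<Rightarrow> ('a \<Rightarrow> 'a \<Rightarrow> 'b::real_vector) \<Rightarrow> 'b" where
  "trace_on S b = (\<Sum>e\<in>(SOME B. orthonormal_basis S B). b e e)"

definition hs_norm :: "'a::euclidean_space set \<Rightarrow> ('a \<Rightarrow> 'b::real_inner) \<Rightarrow> real" where
  "hs_norm S L = sqrt (trace_on S (\<lambda>x y. L x \<bullet> L y))"


section \<open>Geometry of a submanifold of a submanifold of Euclidean space\<close>

text \<open>Throughout, \<^term>\<open>M \<subseteq> N\<close> are submanifolds of a Euclidean space with the induced metrics, and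
  vector fields are maps into that Euclidean space. The Levi-Civita connection of \<^term>\<open>N\<close> is the
  tangential part of the Euclidean derivative. So \<^term>\<open>cov N N\<close> and \<^term>\<open>cov M M\<close> are the
  Levi-Civita connections of \<^term>\<open>N\<close> and \<^term>\<open>M\<close>, and \<^term>\<open>cov N M\<close> is the pull-back connection
  on the restriction of the tangent bundle of \<^term>\<open>N\<close> to \<^term>\<open>M\<close>.\<close>

definition cov :: "'a::euclidean_space set \<Rightarrow> 'a set \<Rightarrow> ('a \<Rightarrow> 'a) \<Rightarrow> 'a \<Rightarrow> 'a \<Rightarrow> 'a" where
  "cov N M V p x = proj (tangent_space N p) (der M V p x)"

text \<open>A smooth tangent vector field on \<^term>\<open>M\<close> taking the value \<^term>\<open>x\<close> at \<^term>\<open>p\<close> whenever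
  \<^term>\<open>x \<in> tangent_space M p\<close>. Below, tensors are first defined on vector fields and then evaluated
  on tangent vectors through these extensions; by tensoriality the choice of extension is
  irrelevant.\<close>

definition ext :: "'a::euclidean_space set \<Rightarrow> 'a \<Rightarrow> ('a \<Rightarrow> 'a)" where
  "ext M x = (\<lambda>q. proj (tangent_space M q) x)"

definition lie_bracket :: "'a::euclidean_space set \<Rightarrow> ('a \<Rightarrow> 'a) \<Rightarrow> ('a \<Rightarrow> 'a) \<Rightarrow> 'a \<Rightarrow> 'a" where
  "lie_bracket N X Y p = der N Y p (X p) - der N X p (Y p)"

definition curvature_field ::
  "'a::euclidean_space set \<Rightarrow> ('a \<Rightarrow> 'a) \<Rightarrow> ('a \<Rightarrow> 'a) \<Rightarrow> ('a \<Rightarrow> 'a) \<Rightarrow> 'a \<Rightarrow> 'a" where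
  "curvature_field N X Y Z p =
     cov N N (\<lambda>q. cov N N Z q (Y q)) p (X p) - cov N N (\<lambda>q. cov N N Z q (X q)) p (Y p)
     - cov N N Z p (lie_bracket N X Y p)"

definition curvature :: "'a::euclidean_space set \<Rightarrow> 'a \<Rightarrow> 'a \<Rightarrow> 'a \<Rightarrow> 'a \<Rightarrow> 'a" where
  "curvature N p x y z = curvature_field N (ext N x) (ext N y) (ext N z) p"

definition second_cov_field ::
  "'a::euclidean_space set \<Rightarrow> 'a set \<Rightarrow> ('a \<Rightarrow> 'a) \<Rightarrow> ('a \<Rightarrow> 'a) \<Rightarrow> ('a \<Rightarrow> 'a) \<Rightarrow> 'a \<Rightarrow> 'a" where
  "second_cov_field N M V X Y p =
     cov N M (\<lambda>q. cov N M V q (Y q)) p (X p) - cov N M V p (cov M M Y p (X p))"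

definition rough_laplacian :: "'a::euclidean_space set \<Rightarrow> 'a set \<Rightarrow> ('a \<Rightarrow> 'a) \<Rightarrow> 'a \<Rightarrow> 'a" where
  "rough_laplacian N M V p =
     - trace_on (tangent_space M p) (\<lambda>x y. second_cov_field N M V (ext M x) (ext M y) p)"

definition normal_part :: "'a::euclidean_space set \<Rightarrow> 'a \<Rightarrow> 'a \<Rightarrow> 'a" where
  "normal_part M p v = v - proj (tangent_space M p) v"

definition second_fundamental_field ::
  "'a::euclidean_space set \<Rightarrow> 'a set \<Rightarrow> ('a \<Rightarrow> 'a) \<Rightarrow> ('a \<Rightarrow> 'a) \<Rightarrow> 'a \<Rightarrow> 'a" where
  "second_fundamental_field N M X Y p = normal_part M p (cov N M Y p (X p))"

definition mean_curvature_vector :: "'a::euclidean_space set \<Rightarrow> nat \<Rightarrow> 'a set \<Rightarrow> 'a \<Rightarrow> 'a" where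
  "mean_curvature_vector N m M p =
     (1 / real m) *\<^sub>R trace_on (tangent_space M p)
       (\<lambda>x y. second_fundamental_field N M (ext M x) (ext M y) p)"

definition mean_curvature :: "'a::euclidean_space set \<Rightarrow> nat \<Rightarrow> 'a set \<Rightarrow> 'a \<Rightarrow> real" where
  "mean_curvature N m M p = norm (mean_curvature_vector N m M p)"

definition unit_mean_curvature_vector :: "'a::euclidean_space set \<Rightarrow> nat \<Rightarrow> 'a set \<Rightarrow> 'a \<Rightarrow> 'a" where
  "unit_mean_curvature_vector N m M p =
     mean_curvature_vector N m M p /\<^sub>R mean_curvature N m M p"

definition normal_cov :: "'a::euclidean_space set \<Rightarrow> 'a set \<Rightarrow> ('a \<Rightarrow> 'a) \<Rightarrow> 'a \<Rightarrow> 'a \<Rightarrow> 'a" where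
  "normal_cov N M \<eta> p x = normal_part M p (cov N M \<eta> p x)"

definition weingarten :: "'a::euclidean_space set \<Rightarrow> 'a set \<Rightarrow> ('a \<Rightarrow> 'a) \<Rightarrow> 'a \<Rightarrow> 'a \<Rightarrow> 'a" where
  "weingarten N M \<eta> p x = - proj (tangent_space M p) (cov N M \<eta> p x)"

definition biharmonic :: "'a::euclidean_space set \<Rightarrow> nat \<Rightarrow> 'a set \<Rightarrow> bool" where
  "biharmonic N m M \<longleftrightarrow>
     (let H = mean_curvature_vector N m M in
      \<forall>p\<in>M. rough_laplacian N M H p
        + trace_on (tangent_space M p) (\<lambda>x y. curvature N p x (H p) y) = 0)"

definition PMC :: "'a::euclidean_space set \<Rightarrow> nat \<Rightarrow> 'a set \<Rightarrow> bool" where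
  "PMC N m M \<longleftrightarrow>
     (\<forall>p\<in>M. \<forall>x\<in>tangent_space M p. normal_cov N M (mean_curvature_vector N m M) p x = 0)"

definition PNMC :: "'a::euclidean_space set \<Rightarrow> nat \<Rightarrow> 'a set \<Rightarrow> bool" where
  "PNMC N m M \<longleftrightarrow>
     (\<forall>p\<in>M. mean_curvature N m M p > 0) \<and>
     (\<forall>p\<in>M. \<forall>x\<in>tangent_space M p. normal_cov N M (unit_mean_curvature_vector N m M) p x = 0)"

text \<open>The norm of the Weingarten operator associated to the unit mean curvature vector field.\<close>

definition norm_A :: "'a::euclidean_space set \<Rightarrow> nat \<Rightarrow> 'a set \<Rightarrow> 'a \<Rightarrow> real" where
  "norm_A N m M p =
     hs_norm (tangent_space M p) (weingarten N M (unit_mean_curvature_vector N m M) p)"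

end

theory Submission
  imports Defs
begin

text \<open>Pairing the biharmonic equation with \<open>\<xi>\<close>, and using that \<open>\<xi>\<close> is parallel in the normal
  bundle, gives \<open>\<Delta> f = f (|A|\<^sup>2 - m)\<close> for the mean curvature \<open>f\<close> and the Laplacian \<open>\<Delta> = trace \<nabla>\<^sup>2\<close>. If
  \<open>|A|\<^sup>2 - m\<close> has a sign, \<open>f\<close> or \<open>-f\<close> is superharmonic on a compact connected manifold, hence constant by the
  strong maximum principle. Then \<open>\<nabla>\<^sup>\<bottom> H = 0\<close>, and \<open>|A|\<^sup>2 = m\<close> because \<open>f > 0\<close>. If \<open>|A|\<close> is
  constant, then \<open>|A|\<^sup>2 - m\<close> certainly has a sign.\<close>

section \<open>Calculus of smooth maps\<close>

text \<open>Integrating \<open>\<Delta> f\<close> over M would need a measure and the divergence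
  theorem; the maximum principle needs only derivatives at single points. Computation in charts and
  intrinsic distance are avoided too, which shapes the proof. A function on M is differentiated by
  extending it locally to the ambient space or by composing it with a local retraction onto M.
  Traces are taken over an orthonormal basis chosen anew at each point, so it is not visible that H
  and the Laplacian depend smoothly on the point; rewriting the trace over the fixed ambient basis,
  with its vectors projected to the tangent space, makes it so. Hopf's argument uses ambient balls,
  which might touch the set of minima in a direction normal to M, where the barrier would have no
  gradient along M; this is excluded because sufficiently short secants near a point of M are never
  normal to M. In the equation for f, the term with \<open>|A|^2\<close> arises because the
  derivative of \<open>\<xi>\<close> is tangent to M, and m counts the tangent directions, each
  contributing \<open>-f\<close> through the curvature of the unit sphere.\<close>

lemma Ck_on_cong:
  assumes "open U" "\<And>x. x \<in> U \<Longrightarrow> f x = g x" "Ck_on k U f"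
  shows "Ck_on k U g"
  using assms(2,3)
proof (induction k arbitrary: f g)
  case 0
  then show ?case by (auto cong: continuous_on_cong)
next
  case (Suc k)
  have d: "(g has_derivative frechet_derivative f (at x)) (at x)" if "x \<in> U" for x
    using has_derivative_transform_within_open[of f "frechet_derivative f (at x)" x UNIV U g] Suc.prems assms(1) that
    by (auto simp: frechet_derivative_works)
  have "Ck_on k U (\<lambda>x. frechet_derivative g (at x) v)" for v
  proof (rule Suc.IH)
    show "frechet_derivative f (at x) v = frechet_derivative g (at x) v" if "x \<in> U" for x
      using frechet_derivative_at[OF d[OF that]] by simp
  qed (use Suc.prems in simp)
  with d show ?case by (auto simp: differentiable_def)
qed

text \<open>The recursion in \<open>Ck_on\<close> speaks of \<open>frechet_derivative\<close>, a
  choice operator. This form accepts any explicit formula \<open>F\<close> for the derivative, so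
  that closure properties reduce to naming the derivative and applying the induction hypothesis to
  it.\<close>

lemma Ck_on_Suc:
  assumes "open U" "\<And>x. x \<in> U \<Longrightarrow> (f has_derivative F x) (at x)" "\<And>v. Ck_on k U (\<lambda>x. F x v)"
  shows "Ck_on (Suc k) U f"
proof -
  have "Ck_on k U (\<lambda>x. frechet_derivative f (at x) v)" for v
  proof (rule Ck_on_cong[OF assms(1) _ assms(3)])
    show "F x v = frechet_derivative f (at x) v" if "x \<in> U" for x
      using frechet_derivative_at[OF assms(2)[OF that]] by simp
  qed
  with assms(2) show ?thesis by (auto simp: differentiable_def)
qed

lemma Ck_on_decrease: "open U \<Longrightarrow> Ck_on (Suc k) U f \<Longrightarrow> Ck_on k U f"
proof (induction k arbitrary: f)
  case 0
  then show ?case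
    by (auto intro!: continuous_at_imp_continuous_on differentiable_imp_continuous_within)
qed auto

lemma Ck_on_subset: "Ck_on k U f \<Longrightarrow> V \<subseteq> U \<Longrightarrow> Ck_on k V f"
  by (induction k arbitrary: f) (auto intro: continuous_on_subset)

lemma Ck_on_has_derivative:
  "Ck_on (Suc k) U f \<Longrightarrow> x \<in> U \<Longrightarrow> (f has_derivative frechet_derivative f (at x)) (at x)"
  by (auto simp: frechet_derivative_works)

lemma Ck_on_const [simp]: "open U \<Longrightarrow> Ck_on k U (\<lambda>x. c)"
  by (induction k arbitrary: c) auto

lemma Ck_on_bounded_linear:
  assumes "open U" "bounded_linear L" "Ck_on k U f"
  shows "Ck_on k U (\<lambda>x. L (f x))"
  using assms(3)
proof (induction k arbitrary: f)
  case 0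
  then show ?case using assms(2) by (auto intro: bounded_linear.continuous_on)
next
  case (Suc k)
  show ?case
    by (rule Ck_on_Suc[where F="\<lambda>x v. L (frechet_derivative f (at x) v)"])
      (use assms Suc in \<open>auto intro!: bounded_linear.has_derivative[OF assms(2)] simp: frechet_derivative_works\<close>)
qed

lemma Ck_on_ident: "open U \<Longrightarrow> Ck_on k U (\<lambda>x. x)"
proof (cases k)
  case (Suc j)
  assume "open U"
  then show ?thesis unfolding Suc
    by (intro Ck_on_Suc[where F="\<lambda>x v. v"]) auto
qed auto

lemma Ck_on_add:
  assumes "open U"
  shows "Ck_on k U f \<Longrightarrow> Ck_on k U g \<Longrightarrow> Ck_on k U (\<lambda>x. f x + g x)"
proof (induction k arbitrary: f g)
  case 0
  then show ?case by (auto intro: continuous_on_add)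
next
  case (Suc k)
  show ?case
    by (rule Ck_on_Suc[where F="\<lambda>x v. frechet_derivative f (at x) v + frechet_derivative g (at x) v"])
      (use assms Suc in \<open>auto intro!: has_derivative_add simp: frechet_derivative_works\<close>)
qed

lemma Ck_on_bilinear:
  assumes "open U" "bounded_bilinear B"
  shows "Ck_on k U f \<Longrightarrow> Ck_on k U g \<Longrightarrow> Ck_on k U (\<lambda>x. B (f x) (g x))"
proof (induction k arbitrary: f g)
  case 0
  then show ?case by (auto intro: bounded_bilinear.continuous_on[OF assms(2)])
next
  case (Suc k)
  have f: "Ck_on k U f" and g: "Ck_on k U g"
    using Suc.prems Ck_on_decrease assms(1) by auto
  show ?case
  proof (rule Ck_on_Suc[OF assms(1)])
    fix x assume "x \<in> U"
    then show "((\<lambda>x. B (f x) (g x)) has_derivative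
      (\<lambda>v. B (f x) (frechet_derivative g (at x) v) + B (frechet_derivative f (at x) v) (g x))) (at x)"
      using Suc.prems by (intro bounded_bilinear.FDERIV[OF assms(2)]) (auto simp: frechet_derivative_works)
  next
    fix v
    show "Ck_on k U (\<lambda>x. B (f x) (frechet_derivative g (at x) v) + B (frechet_derivative f (at x) v) (g x))"
      using Suc.prems f g by (intro Ck_on_add assms Suc.IH) auto
  qed
qed

lemma Ck_on_sum:
  assumes "open U" "\<And>i. i \<in> I \<Longrightarrow> Ck_on k U (f i)"
  shows "Ck_on k U (\<lambda>x. \<Sum>i\<in>I. f i x)"
  using assms(2)
proof (induction I rule: infinite_finite_induct)
  case (insert i I)
  have "Ck_on k U (f i)" "Ck_on k U (\<lambda>x. \<Sum>i\<in>I. f i x)"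
    using insert.prems insert.IH by blast+
  from Ck_on_add[OF assms(1) this] insert.hyps show ?case by simp
qed (simp_all add: assms(1))

lemma linear_eq_sum_Basis:
  fixes f :: "'a::euclidean_space \<Rightarrow> 'b::real_vector"
  assumes "linear f"
  shows "f v = (\<Sum>b\<in>Basis. (v \<bullet> b) *\<^sub>R f b)"
proof -
  have "f (\<Sum>b\<in>Basis. (v \<bullet> b) *\<^sub>R b) = (\<Sum>b\<in>Basis. (v \<bullet> b) *\<^sub>R f b)"
    by (simp add: linear_sum[OF assms] linear_cmul[OF assms])
  then show ?thesis by (simp add: euclidean_representation)
qed

text \<open>By the chain rule, \<open>g\<close> is differentiated in the direction
  \<open>frechet_derivative f (at x) v\<close>, which moves with \<open>x\<close>, whereas
  \<open>Ck_on\<close> controls fixed directions only. Expanding the moving direction over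
  \<open>Basis\<close> leaves products of controlled factors; hence the Euclidean space in the
  middle.\<close>

lemma Ck_on_compose:
  fixes g :: "'b::euclidean_space \<Rightarrow> 'c::real_normed_vector"
    and f :: "'a::real_normed_vector \<Rightarrow> 'b"
  assumes "open U" "open V" "f ` U \<subseteq> V"
  shows "Ck_on k U f \<Longrightarrow> Ck_on k V g \<Longrightarrow> Ck_on k U (\<lambda>x. g (f x))"
proof (induction k arbitrary: g)
  case 0
  then show ?case using assms by (auto intro: continuous_on_compose2)
next
  case (Suc k)
  have f: "Ck_on k U f" using Suc.prems Ck_on_decrease assms(1) by auto
  show ?case
  proof (rule Ck_on_Suc[OF assms(1)])
    fix x assume x: "x \<in> U"
    have g': "(g has_derivative frechet_derivative g (at (f x))) (at (f x))"
      using Suc.prems assms x by (auto simp: frechet_derivative_works)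
    have "((\<lambda>x. g (f x)) has_derivative
        (\<lambda>v. frechet_derivative g (at (f x)) (frechet_derivative f (at x) v))) (at x)"
      using has_derivative_compose[where g=g and f=f, OF Ck_on_has_derivative[OF Suc.prems(1) x] g'] .
    then show "((\<lambda>x. g (f x)) has_derivative
        (\<lambda>v. \<Sum>b\<in>Basis. (frechet_derivative f (at x) v \<bullet> b) *\<^sub>R frechet_derivative g (at (f x)) b)) (at x)"
      by (subst (asm) linear_eq_sum_Basis[OF has_derivative_linear[OF g']])
  next
    fix v
    show "Ck_on k U (\<lambda>x. \<Sum>b\<in>Basis. (frechet_derivative f (at x) v \<bullet> b) *\<^sub>R frechet_derivative g (at (f x)) b)"
      using Suc.prems f
      by (intro Ck_on_sum Ck_on_bilinear[OF _ bounded_bilinear_scaleR] assms Suc.IH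
          Ck_on_bounded_linear[OF assms(1) bounded_linear_inner_left]) auto
  qed
qed

text \<open>The derivative is a multiple of the square of the function itself, so the induction
  hypothesis covers it.\<close>

lemma Ck_on_inverse: "Ck_on k (- {0}) (inverse :: real \<Rightarrow> real)"
proof (induction k)
  case 0
  show ?case by (auto intro!: continuous_on_inverse)
next
  case (Suc k)
  have op: "open (- {0::real})" by auto
  show ?case
  proof (rule Ck_on_Suc[OF op])
    fix x :: real assume "x \<in> - {0}"
    then show "(inverse has_derivative (\<lambda>v. - (v * (inverse x * inverse x)))) (at x)"
      by (auto intro!: derivative_eq_intros)
  next
    fix v :: real
    show "Ck_on k (- {0}) (\<lambda>x. - (v * (inverse x * inverse x)))"
      by (intro Ck_on_bounded_linear[OF op bounded_linear_minus[OF bounded_linear_ident]]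
          Ck_on_bounded_linear[OF op bounded_linear_mult_right] Ck_on_bilinear[OF op bounded_bilinear_mult] Suc)
  qed
qed

text \<open>Up to a constant the derivative is the reciprocal of the function itself, so the
  induction closes through \<open>Ck_on_inverse\<close>.\<close>

lemma Ck_on_sqrt: "Ck_on k {0<..} sqrt"
proof (induction k)
  case 0
  show ?case by (auto intro!: continuous_on_real_sqrt)
next
  case (Suc k)
  show ?case
  proof (rule Ck_on_Suc)
    fix x :: real assume "x \<in> {0<..}"
    then show "(sqrt has_derivative (\<lambda>v. (v / 2) * inverse (sqrt x))) (at x)"
      by (auto intro!: derivative_eq_intros simp: field_simps)
  next
    fix v :: real
    show "Ck_on k {0<..} (\<lambda>x. v / 2 * inverse (sqrt x))"
      by (rule Ck_on_bounded_linear[OF _ bounded_linear_mult_right], simp,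
          rule Ck_on_compose[OF _ _ _ Suc Ck_on_inverse]) auto
  qed auto
qed

lemma smooth_on_cong: "open U \<Longrightarrow> (\<And>x. x \<in> U \<Longrightarrow> f x = g x) \<Longrightarrow> smooth_on U f \<Longrightarrow> smooth_on U g"
  unfolding smooth_on_def by (blast intro: Ck_on_cong)

lemma smooth_on_subset: "smooth_on U f \<Longrightarrow> V \<subseteq> U \<Longrightarrow> smooth_on V f"
  unfolding smooth_on_def by (blast intro: Ck_on_subset)

lemma smooth_on_const: "open U \<Longrightarrow> smooth_on U (\<lambda>x. c)"
  by (simp add: smooth_on_def)

lemma smooth_on_ident: "open U \<Longrightarrow> smooth_on U (\<lambda>x. x)"
  by (simp add: smooth_on_def Ck_on_ident)

lemma smooth_on_bounded_linear:
  "open U \<Longrightarrow> bounded_linear L \<Longrightarrow> smooth_on U f \<Longrightarrow> smooth_on U (\<lambda>x. L (f x))"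
  by (simp add: smooth_on_def Ck_on_bounded_linear)

lemma smooth_on_add: "open U \<Longrightarrow> smooth_on U f \<Longrightarrow> smooth_on U g \<Longrightarrow> smooth_on U (\<lambda>x. f x + g x)"
  by (simp add: smooth_on_def Ck_on_add)

lemma smooth_on_bilinear:
  "open U \<Longrightarrow> bounded_bilinear B \<Longrightarrow> smooth_on U f \<Longrightarrow> smooth_on U g \<Longrightarrow> smooth_on U (\<lambda>x. B (f x) (g x))"
  by (simp add: smooth_on_def Ck_on_bilinear)

lemma smooth_on_compose:
  fixes g :: "'b::euclidean_space \<Rightarrow> 'c::real_normed_vector"
  assumes "open U" "open V" "f ` U \<subseteq> V" "smooth_on U f" "smooth_on V g"
  shows "smooth_on U (\<lambda>x. g (f x))"
  using assms unfolding smooth_on_def by (blast intro: Ck_on_compose)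

lemma smooth_on_inverse:
  fixes f :: "'a::real_normed_vector \<Rightarrow> real"
  assumes "open U" "smooth_on U f" "\<And>x. x \<in> U \<Longrightarrow> f x \<noteq> 0"
  shows "smooth_on U (\<lambda>x. inverse (f x))"
  by (rule smooth_on_compose[where V="- {0}"])
    (use assms Ck_on_inverse in \<open>auto simp: smooth_on_def\<close>)

lemma smooth_on_norm:
  fixes f :: "'a::real_normed_vector \<Rightarrow> 'b::real_inner"
  assumes "open U" "smooth_on U f" "\<And>x. x \<in> U \<Longrightarrow> f x \<noteq> 0"
  shows "smooth_on U (\<lambda>x. norm (f x))"
proof -
  have "smooth_on U (\<lambda>x. f x \<bullet> f x)" "smooth_on {0<..} sqrt"
    by (rule smooth_on_bilinear[OF assms(1) bounded_bilinear_inner assms(2,2)]) (simp add: smooth_on_def Ck_on_sqrt)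
  then show ?thesis
    unfolding norm_eq_sqrt_inner
    by (rule smooth_on_compose[OF assms(1) open_greaterThan, rotated]) (use assms(3) in auto)
qed

lemma smooth_on_has_derivative:
  "smooth_on U f \<Longrightarrow> x \<in> U \<Longrightarrow> (f has_derivative frechet_derivative f (at x)) (at x)"
  unfolding smooth_on_def using Ck_on_has_derivative by blast

lemma smooth_on_frechet_derivative:
  "smooth_on U f \<Longrightarrow> smooth_on U (\<lambda>x. frechet_derivative f (at x) v)"
  unfolding smooth_on_def by (metis Ck_on.simps(2))

lemma smooth_on_continuous_on: "smooth_on U f \<Longrightarrow> continuous_on U f"
  unfolding smooth_on_def by (metis Ck_on.simps(1))

lemma smooth_on_sum:
  "open U \<Longrightarrow> (\<And>i. i \<in> I \<Longrightarrow> smooth_on U (f i)) \<Longrightarrow> smooth_on U (\<lambda>x. \<Sum>i\<in>I. f i x)"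
  unfolding smooth_on_def by (simp add: Ck_on_sum)

lemma smooth_on_frechet_derivative_apply:
  fixes f :: "'a::euclidean_space \<Rightarrow> 'b::real_normed_vector"
  assumes "open U" "smooth_on U f" "smooth_on U X"
  shows "smooth_on U (\<lambda>x. frechet_derivative f (at x) (X x))"
proof (rule smooth_on_cong[OF assms(1)])
  show "smooth_on U (\<lambda>x. \<Sum>b\<in>Basis. (X x \<bullet> b) *\<^sub>R frechet_derivative f (at x) b)"
    using assms by (intro smooth_on_sum smooth_on_bilinear[OF _ bounded_bilinear_scaleR]
      smooth_on_bounded_linear[OF _ bounded_linear_inner_left] smooth_on_frechet_derivative)
  show "(\<Sum>b\<in>Basis. (X x \<bullet> b) *\<^sub>R frechet_derivative f (at x) b) = frechet_derivative f (at x) (X x)"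
    if "x \<in> U" for x
    by (rule linear_eq_sum_Basis[OF has_derivative_linear[OF smooth_on_has_derivative[OF assms(2) that]], symmetric])
qed

section \<open>Projections and traces\<close>

lemma proj_exists_unique:
  assumes "subspace (S :: 'a::euclidean_space set)"
  shows "\<exists>!w. w \<in> S \<and> (\<forall>z\<in>S. orthogonal (v - w) z)"
proof -
  obtain y z where yz: "y \<in> span S" "\<And>w. w \<in> span S \<Longrightarrow> orthogonal z w" "v = y + z"
    using orthogonal_subspace_decomp_exists[of S v] by blast
  have S: "span S = S" using assms by simp
  show ?thesis
  proof (rule ex1I[of _ y])
    show "y \<in> S \<and> (\<forall>z\<in>S. orthogonal (v - y) z)" using yz S by auto
    fix w assume w: "w \<in> S \<and> (\<forall>z\<in>S. orthogonal (v - w) z)"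
    have "y - w \<in> S" using w yz S assms by (auto intro: subspace_diff)
    then have "(v - w) \<bullet> (y - w) = 0" "z \<bullet> (y - w) = 0"
      using w yz S unfolding orthogonal_def by auto
    then have "(y - w) \<bullet> (y - w) = 0" using yz(3) by (simp add: inner_diff_left inner_add_left)
    then show "w = y" by simp
  qed
qed

lemma proj_in: "subspace S \<Longrightarrow> proj S v \<in> S"
  using theI'[OF proj_exists_unique[of S v]] unfolding proj_def by blast

lemma inner_proj: "subspace S \<Longrightarrow> z \<in> S \<Longrightarrow> proj S v \<bullet> z = v \<bullet> z"
  using theI'[OF proj_exists_unique[of S v]] unfolding proj_def orthogonal_def
  by (auto simp: inner_diff_left)

lemma proj_eqI:
  assumes "subspace S" "w \<in> S" "\<And>z. z \<in> S \<Longrightarrow> w \<bullet> z = v \<bullet> z"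
  shows "proj S v = w"
  unfolding proj_def
  by (rule the1_equality[OF proj_exists_unique[OF assms(1)]])
    (use assms in \<open>auto simp: orthogonal_def inner_diff_left\<close>)

lemma proj_id: "subspace S \<Longrightarrow> v \<in> S \<Longrightarrow> proj S v = v"
  by (rule proj_eqI) auto

lemma linear_proj: "subspace S \<Longrightarrow> linear (proj S)"
  by (intro linearI proj_eqI)
    (auto simp: inner_proj inner_add_left proj_in subspace_add subspace_scale)

lemma bounded_linear_proj: "subspace S \<Longrightarrow> bounded_linear (proj S)"
  by (simp add: linear_proj linear_conv_bounded_linear[symmetric])

lemma proj_eq_0: "subspace S \<Longrightarrow> (\<And>z. z \<in> S \<Longrightarrow> v \<bullet> z = 0) \<Longrightarrow> proj S v = 0"
  by (rule proj_eqI) (auto simp: subspace_0)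

text \<open>One Gram-Schmidt step. The component \<open>w\<close> of \<open>b\<close> orthogonal to
  \<open>span S\<close> is left unnormalised, so the formula contains a quotient but no square
  root.\<close>

lemma proj_span_insert:
  fixes b :: "'a::euclidean_space"
  assumes w: "w = b - proj (span S) b" "w \<noteq> 0"
  shows "proj (span (insert b S)) v = proj (span S) v + ((v \<bullet> w) / (w \<bullet> w)) *\<^sub>R w"
proof (rule proj_eqI)
  have "proj (span S) x \<in> span S" for x by (simp add: proj_in)
  then have S: "proj (span S) x \<in> span (insert b S)" for x
    using span_mono[of S "insert b S"] by blast
  then have wS: "w \<in> span (insert b S)"
    unfolding w by (intro span_diff) (auto intro: span_base)
  show "proj (span S) v + (v \<bullet> w / (w \<bullet> w)) *\<^sub>R w \<in> span (insert b S)"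
    using S wS by (intro span_add span_scale)
  fix z assume "z \<in> span (insert b S)"
  then obtain k where k: "z - k *\<^sub>R b \<in> span S" using span_breakdown_eq by blast
  define y where "y = z - k *\<^sub>R b + k *\<^sub>R proj (span S) b"
  have y: "y \<in> span S" "z = y + k *\<^sub>R w"
    unfolding y_def w using k by (intro span_add span_scale proj_in) (simp_all add: algebra_simps)
  have wy: "w \<bullet> x = 0" if "x \<in> span S" for x
    unfolding w using that by (simp add: inner_diff_left inner_proj)
  have "proj (span S) v \<bullet> w = 0" by (subst inner_commute) (simp add: wy proj_in)
  with wy[OF y(1)] show "(proj (span S) v + (v \<bullet> w / (w \<bullet> w)) *\<^sub>R w) \<bullet> z = v \<bullet> z"
    using w(2) y by (simp add: inner_add_left inner_add_right inner_proj)
qed simp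

text \<open>Induction along Gram-Schmidt; independence at every point keeps the denominator
  \<open>w x \<bullet> w x\<close> nonzero. The induction is over all \<open>g\<close> because the
  hypothesis serves both for \<open>g\<close> and for the newly inserted vector
  \<open>f i\<close>.\<close>

lemma smooth_on_proj_span:
  fixes f :: "'i \<Rightarrow> 'b::euclidean_space \<Rightarrow> 'a::euclidean_space"
  assumes "finite I" "open U" "\<And>i. i \<in> I \<Longrightarrow> smooth_on U (f i)"
    "\<And>x. x \<in> U \<Longrightarrow> inj_on (\<lambda>i. f i x) I \<and> independent ((\<lambda>i. f i x) ` I)"
  shows "smooth_on U g \<Longrightarrow> smooth_on U (\<lambda>x. proj (span ((\<lambda>i. f i x) ` I)) (g x))"
  using assms(1,3,4)
proof (induction I arbitrary: g rule: finite_induct)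
  case empty
  have "proj {0} v = 0" for v :: 'a by (rule proj_eq_0) auto
  then show ?case using assms(2) by (simp add: smooth_on_const)
next
  case (insert i I)
  have ind: "inj_on (\<lambda>i. f i x) I \<and> independent ((\<lambda>i. f i x) ` I)" if "x \<in> U" for x
    using insert.prems(3)[OF that] independent_mono[OF _ subset_insertI] by simp blast
  have IH: "smooth_on U (\<lambda>x. proj (span ((\<lambda>i. f i x) ` I)) (h x))" if "smooth_on U h" for h
    by (rule insert.IH[OF that]) (use insert.prems ind in auto)
  define w where "w x = f i x - proj (span ((\<lambda>i. f i x) ` I)) (f i x)" for x
  have sm: "smooth_on U w"
    unfolding w_def diff_conv_add_uminus
    by (intro smooth_on_add smooth_on_bounded_linear[OF _ bounded_linear_minus[OF bounded_linear_ident]] IH assms(2) insert.prems(2)) auto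
  have w0: "w x \<noteq> 0" if "x \<in> U" for x
  proof
    assume "w x = 0"
    then have "f i x \<in> span ((\<lambda>i. f i x) ` I)"
      unfolding w_def by (metis eq_iff_diff_eq_0 proj_in subspace_span)
    moreover have "f i x \<notin> (\<lambda>i. f i x) ` I"
      using insert.prems(3)[OF that] insert.hyps by auto
    moreover have "independent (insert (f i x) ((\<lambda>i. f i x) ` I))"
      using insert.prems(3)[OF that] by simp
    ultimately show False by (simp add: independent_insert)
  qed
  have in1: "smooth_on U (\<lambda>x. g x \<bullet> w x)" and in2: "smooth_on U (\<lambda>x. w x \<bullet> w x)"
    using smooth_on_bilinear[OF assms(2) bounded_bilinear_inner] sm insert.prems(1) by blast+
  have in3: "smooth_on U (\<lambda>x. inverse (w x \<bullet> w x))"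
    by (rule smooth_on_inverse[OF assms(2) in2]) (use w0 in auto)
  have "smooth_on U (\<lambda>x. proj (span ((\<lambda>i. f i x) ` I)) (g x) + ((g x \<bullet> w x) * inverse (w x \<bullet> w x)) *\<^sub>R w x)"
    by (intro smooth_on_add[OF assms(2)] smooth_on_bilinear[OF assms(2) bounded_bilinear_scaleR]
        smooth_on_bilinear[OF assms(2) bounded_bilinear_mult] IH in1 in3 sm insert.prems(1))
  then show ?case
  proof (rule smooth_on_cong[OF assms(2), rotated])
    fix x assume "x \<in> U"
    show "proj (span ((\<lambda>i. f i x) ` I)) (g x) + ((g x \<bullet> w x) * inverse (w x \<bullet> w x)) *\<^sub>R w x =
      proj (span ((\<lambda>i. f i x) ` insert i I)) (g x)"
      using proj_span_insert[OF w_def w0[OF \<open>x \<in> U\<close>], of "g x"] by (simp add: divide_inverse)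
  qed
qed

text \<open>A name for the basis that \<open>trace_on\<close> selects. Nothing is known about how
  this choice varies with the subspace, so sums over it are good for pointwise identities but not
  for smoothness.\<close>

definition onb :: "'a::euclidean_space set \<Rightarrow> 'a set" where
  "onb S = (SOME B. orthonormal_basis S B)"

lemma trace_on_onb: "trace_on S b = (\<Sum>e\<in>onb S. b e e)"
  by (simp add: trace_on_def onb_def)

lemma orthonormal_basis_onb: "subspace S \<Longrightarrow> orthonormal_basis S (onb S)"
  unfolding onb_def
  by (rule someI_ex) (metis orthonormal_basis_subspace orthonormal_basis_def)

lemma
  assumes "subspace S"
  shows onb_subset: "onb S \<subseteq> S" and norm_onb: "e \<in> onb S \<Longrightarrow> norm e = 1"
    and finite_onb: "finite (onb S)" and card_onb: "card (onb S) = dim S"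
    and onb_expand: "x \<in> S \<Longrightarrow> (\<Sum>e\<in>onb S. (x \<bullet> e) *\<^sub>R e) = x"
proof -
  have *: "pairwise orthogonal (onb S)" "\<And>e. e \<in> onb S \<Longrightarrow> norm e = 1" "span (onb S) = S"
    using orthonormal_basis_onb[OF assms] unfolding orthonormal_basis_def by auto
  show "onb S \<subseteq> S" using *(3) span_superset by blast
  show "e \<in> onb S \<Longrightarrow> norm e = 1" by fact
  have "0 \<notin> onb S" using *(2) by force
  then have ind: "independent (onb S)" by (rule pairwise_orthogonal_independent[OF *(1)])
  then show fin: "finite (onb S)" using independent_imp_finite by blast
  show "card (onb S) = dim S" using dim_eq_card_independent[OF ind] dim_span *(3) by metis
  show "(\<Sum>e\<in>onb S. (x \<bullet> e) *\<^sub>R e) = x" if "x \<in> S"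
    by (rule orthonormal_basis_expand[OF *(1) _ _ fin]) (use *(2,3) that in auto)
qed

lemma proj_onb: "subspace S \<Longrightarrow> proj S v = (\<Sum>e\<in>onb S. (v \<bullet> e) *\<^sub>R e)"
  using onb_expand[of S "proj S v"] onb_subset[of S] inner_proj
  by (smt (verit) proj_in subset_iff sum.cong)

text \<open>Both sides are \<open>\<Sum>\<^sub>b \<Sum>\<^sub>e (b \<bullet> e) \<beta> e b\<close>; the right-hand side makes the dependence on
  the subspace explicit, hence smooth.\<close>

lemma trace_on_eq_sum_Basis:
  fixes \<beta> :: "'a::euclidean_space \<Rightarrow> 'a \<Rightarrow> 'b::real_vector"
  assumes S: "subspace S" and 1: "\<And>x y x' c. x \<in> S \<Longrightarrow> x' \<in> S \<Longrightarrow> \<beta> (x + c *\<^sub>R x') y = \<beta> x y + c *\<^sub>R \<beta> x' y"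
    and 2: "\<And>x. x \<in> S \<Longrightarrow> linear (\<beta> x)"
  shows "trace_on S \<beta> = (\<Sum>b\<in>Basis. \<beta> (proj S b) b)"
proof -
  have "\<beta> (\<Sum>e\<in>E. c e *\<^sub>R e) y = (\<Sum>e\<in>E. c e *\<^sub>R \<beta> e y)" if "finite E" "E \<subseteq> S" for E c y
    using that
  proof (induction E rule: finite_induct)
    case empty
    \<comment> \<open>The first hypothesis at the zero vector with \<open>c = 1\<close> forces
      \<open>\<beta> 0 y = 0\<close>.\<close>
    have "\<beta> 0 y = \<beta> 0 y + 1 *\<^sub>R \<beta> 0 y" using 1[of 0 0 1 y] S by (simp add: subspace_0)
    then show ?case by simp
  next
    case (insert e E)
    have "(\<Sum>e\<in>E. c e *\<^sub>R e) \<in> S" using insert.prems S by (auto intro!: subspace_sum subspace_scale)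
    then have "\<beta> ((\<Sum>e\<in>E. c e *\<^sub>R e) + c e *\<^sub>R e) y = (\<Sum>e\<in>E. c e *\<^sub>R \<beta> e y) + c e *\<^sub>R \<beta> e y"
      using insert by (simp add: 1)
    then show ?case using insert.hyps by (simp add: add.commute)
  qed
  then have "\<beta> (proj S b) b = (\<Sum>e\<in>onb S. (b \<bullet> e) *\<^sub>R \<beta> e b)" for b
    using S by (simp add: proj_onb finite_onb onb_subset)
  then have "(\<Sum>b\<in>Basis. \<beta> (proj S b) b) = (\<Sum>e\<in>onb S. \<Sum>b\<in>Basis. (b \<bullet> e) *\<^sub>R \<beta> e b)"
    by simp (rule sum.swap)
  also have "\<dots> = (\<Sum>e\<in>onb S. \<beta> e e)"
  proof (rule sum.cong[OF refl])
    fix e assume "e \<in> onb S"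
    then have "linear (\<beta> e)" using 2 onb_subset[OF S] by blast
    from linear_eq_sum_Basis[OF this, of e]
    show "(\<Sum>b\<in>Basis. (b \<bullet> e) *\<^sub>R \<beta> e b) = \<beta> e e" by (simp add: inner_commute)
  qed
  finally show ?thesis by (simp add: trace_on_onb)
qed

section \<open>Smooth maps along a submanifold\<close>

text \<open>Extensions are required only locally, so no partition of unity is ever needed, and
  algebra and differentiation can be carried out on ambient open sets.\<close>

definition smooth_along :: "'a::euclidean_space set \<Rightarrow> ('a \<Rightarrow> 'b::real_normed_vector) \<Rightarrow> bool" where
  "smooth_along M V \<longleftrightarrow>
     (\<forall>p\<in>M. \<exists>U F. open U \<and> p \<in> U \<and> smooth_on U F \<and> (\<forall>q\<in>U \<inter> M. F q = V q))"

lemma smooth_alongE: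
  assumes "smooth_along M V" "p \<in> M"
  obtains U F where "open U" "p \<in> U" "smooth_on U F" "\<And>q. q \<in> U \<Longrightarrow> q \<in> M \<Longrightarrow> F q = V q"
proof -
  from assms obtain U F where "open U" "p \<in> U" "smooth_on U F" "\<forall>q\<in>U \<inter> M. F q = V q"
    unfolding smooth_along_def by meson
  then show thesis by (intro that[of U F]) auto
qed

lemma smooth_along_smooth_on: "open U \<Longrightarrow> M \<subseteq> U \<Longrightarrow> smooth_on U F \<Longrightarrow> smooth_along M F"
  unfolding smooth_along_def by blast

lemma smooth_along_const: "smooth_along M (\<lambda>q. c)"
  by (rule smooth_along_smooth_on[of UNIV]) (auto intro: smooth_on_const)

lemma smooth_along_ident: "smooth_along M (\<lambda>q. q)"
  by (rule smooth_along_smooth_on[of UNIV]) (auto intro: smooth_on_ident)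

lemma smooth_along_cong:
  assumes "\<And>q. q \<in> M \<Longrightarrow> V q = W q" "smooth_along M V"
  shows "smooth_along M W"
  using assms unfolding smooth_along_def by (metis IntD2)

lemma smooth_along_bounded_linear:
  assumes "bounded_linear L" "smooth_along M V"
  shows "smooth_along M (\<lambda>q. L (V q))"
  unfolding smooth_along_def
proof
  fix p assume "p \<in> M"
  obtain U F where "open U" "p \<in> U" "smooth_on U F" "\<And>q. q \<in> U \<Longrightarrow> q \<in> M \<Longrightarrow> F q = V q"
    by (rule smooth_alongE[OF assms(2) \<open>p \<in> M\<close>]; rule that)
  with smooth_on_bounded_linear[OF _ assms(1)]
  show "\<exists>U F. open U \<and> p \<in> U \<and> smooth_on U F \<and> (\<forall>q\<in>U \<inter> M. F q = L (V q))"
    by (intro exI[of _ U] exI[of _ "\<lambda>q. L (F q)"]) auto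
qed

text \<open>The operation \<open>B\<close> is kept abstract so that addition, which is not bilinear,
  and all bilinear products share one argument: intersect the two neighbourhoods and combine the
  extensions.\<close>

lemma smooth_along_combine:
  fixes M :: "'a::euclidean_space set"
    and B :: "'b::real_normed_vector \<Rightarrow> 'c::real_normed_vector \<Rightarrow> 'd::real_normed_vector"
  assumes "\<And>(U :: 'a set) F G. open U \<Longrightarrow> smooth_on U F \<Longrightarrow> smooth_on U G \<Longrightarrow> smooth_on U (\<lambda>q. B (F q) (G q))"
    "smooth_along M V" "smooth_along M W"
  shows "smooth_along M (\<lambda>q. B (V q) (W q))"
  unfolding smooth_along_def
proof
  fix p assume "p \<in> M"
  obtain U F where U: "open U" "p \<in> U" "smooth_on U F" "\<And>q. q \<in> U \<Longrightarrow> q \<in> M \<Longrightarrow> F q = V q"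
    by (rule smooth_alongE[OF assms(2) \<open>p \<in> M\<close>]; rule that)
  obtain U' G where U': "open U'" "p \<in> U'" "smooth_on U' G" "\<And>q. q \<in> U' \<Longrightarrow> q \<in> M \<Longrightarrow> G q = W q"
    by (rule smooth_alongE[OF assms(3) \<open>p \<in> M\<close>]; rule that)
  have "smooth_on (U \<inter> U') (\<lambda>q. B (F q) (G q))"
    using U U' by (intro assms(1)) (auto intro: smooth_on_subset)
  with U U' show "\<exists>U F. open U \<and> p \<in> U \<and> smooth_on U F \<and> (\<forall>q\<in>U \<inter> M. F q = B (V q) (W q))"
    by (intro exI[of _ "U \<inter> U'"] exI[of _ "\<lambda>q. B (F q) (G q)"]) auto
qed

lemma smooth_along_add: "smooth_along M V \<Longrightarrow> smooth_along M W \<Longrightarrow> smooth_along M (\<lambda>q. V q + W q)"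
  by (rule smooth_along_combine) (rule smooth_on_add)

lemma smooth_along_bilinear:
  "bounded_bilinear B \<Longrightarrow> smooth_along M V \<Longrightarrow> smooth_along M W \<Longrightarrow> smooth_along M (\<lambda>q. B (V q) (W q))"
  by (rule smooth_along_combine) (rule smooth_on_bilinear)

lemmas smooth_along_inner = smooth_along_bilinear[OF bounded_bilinear_inner]
  and smooth_along_scaleR = smooth_along_bilinear[OF bounded_bilinear_scaleR]
  and smooth_along_mult = smooth_along_bilinear[OF bounded_bilinear_mult]

lemma smooth_along_minus: "smooth_along M V \<Longrightarrow> smooth_along M (\<lambda>q. - V q)"
  by (rule smooth_along_bounded_linear[OF bounded_linear_minus[OF bounded_linear_ident]])

lemma smooth_along_diff:
  assumes "smooth_along M V" "smooth_along M W"
  shows "smooth_along M (\<lambda>q. V q - W q)"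
  unfolding diff_conv_add_uminus by (intro smooth_along_add smooth_along_minus assms)

lemma smooth_along_sum:
  assumes "\<And>i. i \<in> I \<Longrightarrow> smooth_along M (V i)"
  shows "smooth_along M (\<lambda>q. \<Sum>i\<in>I. V i q)"
  using assms
proof (induction I rule: infinite_finite_induct)
  case (insert i I)
  have "smooth_along M (V i)" "smooth_along M (\<lambda>q. \<Sum>i\<in>I. V i q)"
    using insert.prems insert.IH by blast+
  from smooth_along_add[OF this] insert.hyps show ?case by simp
qed (simp_all add: smooth_along_const)

lemma smooth_along_continuous_on:
  assumes "smooth_along M V"
  shows "continuous_on M V"
  unfolding continuous_on_eq_continuous_within
proof
  fix p assume p: "p \<in> M"
  obtain U F where U: "open U" "p \<in> U" "smooth_on U F" "\<And>q. q \<in> U \<Longrightarrow> q \<in> M \<Longrightarrow> F q = V q"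
    by (rule smooth_alongE[OF assms p]; rule that)
  have "continuous (at p within M) F"
    using smooth_on_continuous_on[OF U(3)] U(1,2) continuous_on_eq_continuous_at continuous_at_imp_continuous_at_within
    by blast
  moreover obtain e where "e > 0" "ball p e \<subseteq> U" using U open_contains_ball by blast
  ultimately show "continuous (at p within M) V"
    by (elim continuous_transform_within[of p M F e V]) (use p U in \<open>auto simp: dist_commute subset_iff\<close>)
qed

text \<open>Off \<open>M\<close> an extension of \<open>V\<close> may vanish. By continuity it does
  not do so on a smaller neighbourhood, on which reciprocal and norm are smooth.\<close>

lemma smooth_along_nonzero:
  assumes "smooth_along M V" "\<And>q. q \<in> M \<Longrightarrow> V q \<noteq> 0" "p \<in> M"
  obtains U F where "open U" "p \<in> U" "smooth_on U F" "\<And>q. q \<in> U \<Longrightarrow> q \<in> M \<Longrightarrow> F q = V q"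
    "\<And>q. q \<in> U \<Longrightarrow> F q \<noteq> 0"
proof -
  obtain U F where U: "open U" "p \<in> U" "smooth_on U F" "\<And>q. q \<in> U \<Longrightarrow> q \<in> M \<Longrightarrow> F q = V q"
    by (rule smooth_alongE[OF assms(1,3)]; rule that)
  have "open (U \<inter> F -` (- {0}))"
    using smooth_on_continuous_on[OF U(3)] U(1) by (intro continuous_open_preimage) auto
  then show ?thesis
    by (rule that[of "U \<inter> F -` (- {0})" F]) (use U assms in \<open>auto intro: smooth_on_subset\<close>)
qed

lemma smooth_along_inverse:
  fixes V :: "'a::euclidean_space \<Rightarrow> real"
  assumes "smooth_along M V" "\<And>q. q \<in> M \<Longrightarrow> V q \<noteq> 0"
  shows "smooth_along M (\<lambda>q. inverse (V q))"
  unfolding smooth_along_def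
proof
  fix p assume "p \<in> M"
  obtain U F where "open U" "p \<in> U" "smooth_on U F" "\<And>q. q \<in> U \<Longrightarrow> q \<in> M \<Longrightarrow> F q = V q"
    "\<And>q. q \<in> U \<Longrightarrow> F q \<noteq> 0"
    by (rule smooth_along_nonzero[OF assms \<open>p \<in> M\<close>], assumption, rule that)
  with smooth_on_inverse show "\<exists>U F. open U \<and> p \<in> U \<and> smooth_on U F \<and> (\<forall>q\<in>U \<inter> M. F q = inverse (V q))"
    by (intro exI[of _ U] exI[of _ "\<lambda>q. inverse (F q)"]) auto
qed

lemma smooth_along_norm:
  fixes V :: "'a::euclidean_space \<Rightarrow> 'b::real_inner"
  assumes "smooth_along M V" "\<And>q. q \<in> M \<Longrightarrow> V q \<noteq> 0"
  shows "smooth_along M (\<lambda>q. norm (V q))"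
  unfolding smooth_along_def
proof
  fix p assume "p \<in> M"
  obtain U F where "open U" "p \<in> U" "smooth_on U F" "\<And>q. q \<in> U \<Longrightarrow> q \<in> M \<Longrightarrow> F q = V q"
    "\<And>q. q \<in> U \<Longrightarrow> F q \<noteq> 0"
    by (rule smooth_along_nonzero[OF assms \<open>p \<in> M\<close>], assumption, rule that)
  with smooth_on_norm show "\<exists>U F. open U \<and> p \<in> U \<and> smooth_on U F \<and> (\<forall>q\<in>U \<inter> M. F q = norm (V q))"
    by (intro exI[of _ U] exI[of _ "\<lambda>q. norm (F q)"]) auto
qed

section \<open>Derivatives along \<open>M\<close> of maps given on \<open>M\<close>\<close>

text \<open>\<open>der\<close> selects one of possibly many derivatives within \<open>M\<close>, but
  all of them agree on tangent vectors, so there any derivative computes it.\<close>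

lemma der_eqI:
  "(V has_derivative D) (at p within M) \<Longrightarrow> x \<in> tangent_space M p \<Longrightarrow> der M V p x = D x"
  by (meson derivative_within_unique_on_tangent_space differentiableI frechet_derivative_works)

lemma has_derivative_within_extension:
  assumes "open U" "q \<in> U" "q \<in> M" "(F has_derivative D) (at q)" "\<And>q. q \<in> U \<Longrightarrow> q \<in> M \<Longrightarrow> F q = V q"
  shows "(V has_derivative D) (at q within M)"
proof -
  obtain e where "e > 0" "ball q e \<subseteq> U" using assms open_contains_ball by blast
  with assms show ?thesis
    by (intro has_derivative_transform_within[OF has_derivative_at_withinI[OF assms(4)], of e M])
      (auto simp: dist_commute subset_iff)
qed

lemma der_extension:
  assumes "open U" "q \<in> U" "q \<in> M" "smooth_on U F" "\<And>q. q \<in> U \<Longrightarrow> q \<in> M \<Longrightarrow> F q = V q"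
    and "x \<in> tangent_space M q"
  shows "der M V q x = frechet_derivative F (at q) x"
  using has_derivative_within_extension[OF assms(1-3) smooth_on_has_derivative[OF assms(4,2)] assms(5)]
    assms(6) by (rule der_eqI)

lemma smooth_along_has_derivative:
  assumes "smooth_along M V" "p \<in> M"
  shows "(V has_derivative der M V p) (at p within M)"
proof -
  obtain U F where U: "open U" "p \<in> U" "smooth_on U F" "\<And>q. q \<in> U \<Longrightarrow> q \<in> M \<Longrightarrow> F q = V q"
    by (rule smooth_alongE[OF assms]; rule that)
  have "(V has_derivative frechet_derivative F (at p)) (at p within M)"
    by (rule has_derivative_within_extension[OF U(1,2) assms(2) smooth_on_has_derivative[OF U(3,2)] U(4)])
  then show ?thesis using differentiableI frechet_derivative_works by blast
qed

lemma linear_der: "smooth_along M V \<Longrightarrow> p \<in> M \<Longrightarrow> linear (der M V p)"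
  by (rule has_derivative_linear[OF smooth_along_has_derivative])

text \<open>Both maps have the same derivatives within \<open>M\<close>, so the choice operator
  makes the same selection. The equality therefore holds for the whole linear map, not only on
  tangent vectors, and can be used for rewriting.\<close>

lemma der_cong:
  assumes "p \<in> M" "\<And>q. q \<in> M \<Longrightarrow> V q = W q"
  shows "der M V p = der M W p"
proof -
  have "(V has_derivative D) (at p within M) \<longleftrightarrow> (W has_derivative D) (at p within M)" for D
    using assms by (metis has_derivative_transform)
  then show ?thesis unfolding frechet_derivative_def by simp
qed

lemma der_const: "x \<in> tangent_space M p \<Longrightarrow> der M (\<lambda>q. c) p x = 0"
  by (rule der_eqI[OF has_derivative_const])

lemma der_ident: "x \<in> tangent_space M p \<Longrightarrow> der M (\<lambda>q. q) p x = x"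
  by (rule der_eqI[OF has_derivative_ident])

context
  fixes M :: "'a::euclidean_space set" and p x
  assumes p: "p \<in> M" and x: "x \<in> tangent_space M p"
begin

lemma der_bounded_linear:
  assumes "bounded_linear L" "smooth_along M V"
  shows "der M (\<lambda>q. L (V q)) p x = L (der M V p x)"
  by (rule der_eqI[OF bounded_linear.has_derivative[OF assms(1) smooth_along_has_derivative[OF assms(2) p]] x])

lemma der_add:
  "smooth_along M V \<Longrightarrow> smooth_along M W \<Longrightarrow> der M (\<lambda>q. V q + W q) p x = der M V p x + der M W p x"
  by (rule der_eqI[OF has_derivative_add x]) (simp_all add: p smooth_along_has_derivative)

lemma der_bilinear:
  assumes "bounded_bilinear B" "smooth_along M V" "smooth_along M W"
  shows "der M (\<lambda>q. B (V q) (W q)) p x = B (V p) (der M W p x) + B (der M V p x) (W p)"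
  by (rule der_eqI[OF bounded_bilinear.FDERIV[OF assms(1)] x])
    (simp_all add: p assms smooth_along_has_derivative)

lemmas der_inner = der_bilinear[OF bounded_bilinear_inner]
  and der_scaleR = der_bilinear[OF bounded_bilinear_scaleR]
  and der_mult = der_bilinear[OF bounded_bilinear_mult]

end

text \<open>The witness is the ambient derivative of an extension of \<open>V\<close> in the
  direction of an extension of \<open>X\<close>. It agrees with \<open>der\<close> at points of
  \<open>M\<close> because \<open>X\<close> is tangent there.\<close>

lemma smooth_along_der:
  fixes V :: "'a::euclidean_space \<Rightarrow> 'b::real_normed_vector"
  assumes "smooth_along M V" "smooth_along M X" "\<And>q. q \<in> M \<Longrightarrow> X q \<in> tangent_space M q"
  shows "smooth_along M (\<lambda>q. der M V q (X q))"
  unfolding smooth_along_def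
proof
  fix p assume p: "p \<in> M"
  obtain U F where U: "open U" "p \<in> U" "smooth_on U F" "\<And>q. q \<in> U \<Longrightarrow> q \<in> M \<Longrightarrow> F q = V q"
    by (rule smooth_alongE[OF assms(1) p]; rule that)
  obtain U' G where U': "open U'" "p \<in> U'" "smooth_on U' G" "\<And>q. q \<in> U' \<Longrightarrow> q \<in> M \<Longrightarrow> G q = X q"
    by (rule smooth_alongE[OF assms(2) p]; rule that)
  have op: "open (U \<inter> U')" using U U' by auto
  have "smooth_on (U \<inter> U') (\<lambda>q. frechet_derivative F (at q) (G q))"
    using U(3) U'(3) by (intro smooth_on_frechet_derivative_apply op) (auto intro: smooth_on_subset)
  moreover have "frechet_derivative F (at q) (G q) = der M V q (X q)" if "q \<in> (U \<inter> U') \<inter> M" for q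
    using der_extension[OF U(1) _ _ U(3,4), where q=q and x="X q"] that U'(4) assms(3) by auto
  ultimately show "\<exists>U F. open U \<and> p \<in> U \<and> smooth_on U F \<and> (\<forall>q\<in>U \<inter> M. F q = der M V q (X q))"
    using op U(2) U'(2) by blast
qed


section \<open>Tangent spaces and local retractions\<close>

text \<open>Plays the part of a chart: composing with \<open>r\<close> turns a function on
  \<open>M\<close> into one on an ambient open set with no loss of information, and at points of
  \<open>M\<close> the derivative of \<open>r\<close> is a projection, in general oblique, onto the
  tangent space.\<close>

definition local_retraction :: "'a::euclidean_space set \<Rightarrow> 'a set \<Rightarrow> ('a \<Rightarrow> 'a) \<Rightarrow> bool" where
  "local_retraction M U r \<longleftrightarrow> open U \<and> smooth_on U r \<and> r ` U \<subseteq> U \<inter> M \<and> (\<forall>q\<in>U \<inter> M. r q = q)"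

lemma local_retraction_tangent:
  assumes r: "local_retraction M U r" and q: "q \<in> U" "q \<in> M" and x: "x \<in> tangent_space M q"
  shows "frechet_derivative r (at q) x = x"
  using der_extension[where F=r and V="\<lambda>q. q" and x=x] der_ident[OF x] assms
  unfolding local_retraction_def by auto

text \<open>The retraction of a straight line through \<open>q\<close> is a curve in
  \<open>M\<close> with velocity \<open>frechet_derivative r (at q) v\<close>; conversely this
  derivative fixes every tangent vector. In particular the set of velocities is a linear subspace,
  which \<open>tangent_space\<close> does not show by itself.\<close>

lemma tangent_space_local_retraction:
  assumes r: "local_retraction M U r" and q: "q \<in> U" "q \<in> M"
  shows "tangent_space M q = range (frechet_derivative r (at q))"
proof
  show "tangent_space M q \<subseteq> range (frechet_derivative r (at q))"
    using local_retraction_tangent[OF assms] by (metis rangeI subsetI)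
  have U: "open U" "smooth_on U r" and rU: "r ` U \<subseteq> U \<inter> M" "r q = q"
    using r q unfolding local_retraction_def by auto
  show "range (frechet_derivative r (at q)) \<subseteq> tangent_space M q"
  proof
    fix x assume "x \<in> range (frechet_derivative r (at q))"
    then obtain v where v: "x = frechet_derivative r (at q) v" by blast
    have "open ((\<lambda>t::real. q + t *\<^sub>R v) -` U)"
      by (intro open_vimage U continuous_intros)
    moreover have "0 \<in> (\<lambda>t::real. q + t *\<^sub>R v) -` U" using q by simp
    ultimately obtain e where e: "e > 0" "ball 0 e \<subseteq> (\<lambda>t::real. q + t *\<^sub>R v) -` U"
      using open_contains_ball by blast
    have b: "ball 0 e = {-e<..<e}" by (auto simp: dist_real_def)
    have line: "(\<lambda>t. q + t *\<^sub>R v) ` {-e<..<e} \<subseteq> U" using e unfolding b by auto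
    have line': "smooth_on {-e<..<e} (\<lambda>t::real. q + t *\<^sub>R v)"
      by (intro smooth_on_add smooth_on_const smooth_on_bounded_linear[OF _ bounded_linear_scaleR_left] smooth_on_ident) auto
    have 1: "smooth_on {-e<..<e} (\<lambda>t. r (q + t *\<^sub>R v))"
      by (rule smooth_on_compose[OF _ U(1) line line' U(2)]) auto
    have 2: "(\<lambda>t. r (q + t *\<^sub>R v)) ` {-e<..<e} \<subseteq> M" using line rU by blast
    have d: "((\<lambda>t::real. q + t *\<^sub>R v) has_derivative (\<lambda>t. t *\<^sub>R v)) (at 0)"
      by (auto intro!: derivative_eq_intros)
    have r': "(r has_derivative frechet_derivative r (at q)) (at (q + 0 *\<^sub>R v))"
      using smooth_on_has_derivative[OF U(2) q(1)] by simp
    have "((\<lambda>t. r (q + t *\<^sub>R v)) has_derivative (\<lambda>t. frechet_derivative r (at q) (t *\<^sub>R v))) (at 0)"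
      by (rule has_derivative_compose[OF d r'])
    then have 3: "((\<lambda>t. r (q + t *\<^sub>R v)) has_vector_derivative x) (at 0)"
      unfolding has_vector_derivative_def v
      using linear_cmul[OF has_derivative_linear[OF smooth_on_has_derivative[OF U(2) q(1)]]] by simp
    show "x \<in> tangent_space M q"
      unfolding tangent_space_def
      by (intro CollectI exI[of _ e] exI[of _ "\<lambda>t. r (q + t *\<^sub>R v)"] conjI e 1 2 3) (simp add: rU)
  qed
qed

text \<open>The retraction is the chart, followed by orthogonal projection to the slice
  \<open>S\<close>, followed by the inverse chart. The tangent projections come from Gram-Schmidt
  applied to the image of a fixed basis of \<open>S\<close> under the derivative of the inverse
  chart.\<close>

lemma submanifold_local:
  fixes M :: "'a::euclidean_space set"
  assumes "submanifold m M" "p \<in> M"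
  obtains U r P where "p \<in> U" "local_retraction M U r"
    "\<And>v. smooth_on U (\<lambda>q. P q v)"
    "\<And>q. q \<in> U \<Longrightarrow> q \<in> M \<Longrightarrow> P q = proj (tangent_space M q)"
    "\<And>q. q \<in> U \<Longrightarrow> q \<in> M \<Longrightarrow> subspace (tangent_space M q) \<and> dim (tangent_space M q) = m"
proof -
  obtain U and \<Phi> \<Psi> :: "'a \<Rightarrow> 'a" and S where U: "open U" "p \<in> U" "open (\<Phi> ` U)"
    and \<Phi>: "smooth_on U \<Phi>" and \<Psi>: "smooth_on (\<Phi> ` U) \<Psi>"
    and inv: "\<And>x. x \<in> U \<Longrightarrow> \<Psi> (\<Phi> x) = x" and S: "subspace S" "dim S = m"
    and slice: "\<Phi> ` (U \<inter> M) = \<Phi> ` U \<inter> S"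
    using assms unfolding submanifold_def by metis
  define pr where "pr x = proj S (\<Phi> x)" for x
  have pr: "smooth_on U pr"
    unfolding pr_def by (rule smooth_on_bounded_linear[OF U(1) bounded_linear_proj[OF S(1)] \<Phi>])
  \<comment> \<open>Projecting to \<open>S\<close> may leave the image of the chart; on
    \<open>W\<close> it does not, so \<open>\<Psi>\<close> can be applied.\<close>
  define W where "W = U \<inter> pr -` (\<Phi> ` U)"
  define r where "r x = \<Psi> (pr x)" for x
  have W: "open W" "W \<subseteq> U" "pr ` W \<subseteq> \<Phi> ` U"
    unfolding W_def using smooth_on_continuous_on[OF pr] U by (auto intro!: continuous_open_preimage)
  have prM: "pr q = \<Phi> q" if "q \<in> U" "q \<in> M" for q
    unfolding pr_def using slice that S by (intro proj_id) auto
  have MW: "q \<in> W" if "q \<in> U" "q \<in> M" for q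
    unfolding W_def using prM[OF that] that by auto
  have rW: "r q \<in> U \<inter> M" if q: "q \<in> W" for q
  proof -
    have "pr q \<in> \<Phi> ` U \<inter> S" using W(3) q proj_in[OF S(1)] unfolding pr_def by blast
    then obtain y where "y \<in> U \<inter> M" "pr q = \<Phi> y" using slice by blast
    then show ?thesis unfolding r_def using inv by auto
  qed
  have retr: "local_retraction M W r"
    unfolding local_retraction_def
  proof (intro conjI ballI)
    show "smooth_on W r"
      unfolding r_def by (rule smooth_on_compose[OF W(1) U(3) W(3) smooth_on_subset[OF pr W(2)] \<Psi>])
    show "r ` W \<subseteq> W \<inter> M" using rW MW by auto
    show "r q = q" if "q \<in> W \<inter> M" for q
      unfolding r_def using that prM W(2) inv by auto
  qed (fact W)
  define L where "L q = frechet_derivative \<Psi> (at (\<Phi> q))" for q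
  have L: "(\<Psi> has_derivative L q) (at (\<Phi> q))" if "q \<in> U" for q
    unfolding L_def using smooth_on_has_derivative[OF \<Psi>] that by blast
  have linL: "linear (L q)" if "q \<in> U" for q using has_derivative_linear[OF L[OF that]] .
  define K where "K q = frechet_derivative \<Phi> (at q)" for q
  have K: "(\<Phi> has_derivative K q) (at q)" if "q \<in> U" for q
    unfolding K_def using smooth_on_has_derivative[OF \<Phi>] that by blast
  have LK: "L q (K q v) = v" if q: "q \<in> U" for q v
  proof -
    have "((\<lambda>x. \<Psi> (\<Phi> x)) has_derivative (\<lambda>v. L q (K q v))) (at q)"
      by (rule has_derivative_compose[OF K[OF q] L[OF q]])
    moreover have "((\<lambda>x. \<Psi> (\<Phi> x)) has_derivative (\<lambda>v. v)) (at q)"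
      by (rule has_derivative_transform_within_open[OF has_derivative_ident U(1) q]) (simp add: inv)
    ultimately show ?thesis by (metis has_derivative_unique)
  qed
  \<comment> \<open>\<open>K q\<close> has a left inverse, and an injective endomorphism of a
    finite-dimensional space is onto. Hence \<open>L q\<close> is a two-sided inverse and is
    injective.\<close>
  have surjK: "surj (K q)" if q: "q \<in> U" for q
    by (rule linear_injective_imp_surjective[OF has_derivative_linear[OF K[OF q]]])
      (metis LK[OF q] injI, rule refl)
  have injL: "inj (L q)" if q: "q \<in> U" for q
    by (rule injI) (metis LK[OF q] surjK[OF q] surjD)
  have T: "tangent_space M q = L q ` S" if q: "q \<in> U" "q \<in> M" for q
  proof -
    have "(pr has_derivative (\<lambda>v. proj S (K q v))) (at q)"
      unfolding pr_def by (rule bounded_linear.has_derivative[OF bounded_linear_proj[OF S(1)] K[OF q(1)]])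
    moreover have "(\<Psi> has_derivative L q) (at (pr q))" using L[OF q(1)] prM[OF q] by simp
    ultimately have "(r has_derivative (\<lambda>v. L q (proj S (K q v)))) (at q)"
      unfolding r_def by (rule has_derivative_compose)
    then have "frechet_derivative r (at q) = (\<lambda>v. L q (proj S (K q v)))"
      by (rule frechet_derivative_at[symmetric])
    then have "tangent_space M q = L q ` proj S ` range (K q)"
      using tangent_space_local_retraction[OF retr MW[OF q] q(2)] by auto
    moreover have "range (proj S) = S" using proj_in[OF S(1)] proj_id[OF S(1)] by (metis image_subset_iff rangeI subsetI subset_antisym)
    ultimately show ?thesis using surjK[OF q(1)] by simp
  qed
  \<comment> \<open>Defined at all ambient points of \<open>W\<close>, as smoothness on an open set
    requires; the span is claimed to be a tangent space only at points of \<open>M\<close>.\<close>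
  define P where "P q = proj (span (L q ` onb S))" for q
  have indB: "independent (onb S)" and spB: "span (onb S) = S"
  proof -
    show "span (onb S) = S" using orthonormal_basis_onb[OF S(1)] unfolding orthonormal_basis_def by auto
    have "0 \<notin> onb S" using norm_onb[OF S(1)] by force
    then show "independent (onb S)"
      using orthonormal_basis_onb[OF S(1)] pairwise_orthogonal_independent unfolding orthonormal_basis_def by blast
  qed
  have spL: "span (L q ` onb S) = tangent_space M q" if q: "q \<in> U" "q \<in> M" for q
    using linear_span_image[OF linL[OF q(1)]] spB T[OF q] by simp
  have "smooth_on W (\<lambda>q. P q v)" for v
    unfolding P_def
  proof (rule smooth_on_proj_span[OF finite_onb[OF S(1)] W(1)])
    fix s assume "s \<in> onb S"
    show "smooth_on W (\<lambda>q. L q s)"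
      unfolding L_def
      by (rule smooth_on_compose[OF W(1) U(3) _ smooth_on_subset[OF \<Phi> W(2)] smooth_on_frechet_derivative[OF \<Psi>]])
        (use W(2) in auto)
  next
    fix q assume "q \<in> W"
    then have q: "q \<in> U" using W(2) by auto
    then show "inj_on (L q) (onb S) \<and> independent (L q ` onb S)"
      using linear_independent_injective_image[OF linL[OF q] indB] inj_on_subset[OF injL[OF q]] by blast
  qed (simp add: smooth_on_const W)
  moreover have "P q = proj (tangent_space M q)" if "q \<in> W" "q \<in> M" for q
    unfolding P_def using spL that W(2) by (simp add: subset_iff)
  moreover have "subspace (tangent_space M q) \<and> dim (tangent_space M q) = m" if "q \<in> W" "q \<in> M" for q
  proof -
    have q: "q \<in> U" using that W(2) by auto
    have "inj_on (L q) (span S)" using injL[OF q] by (rule inj_on_subset) auto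
    then have "dim (L q ` S) = dim S" by (rule dim_image_eq[OF linL[OF q]])
    then show ?thesis
      using T[OF q that(2)] linear_subspace_image[OF linL[OF q] S(1)] S(2) by simp
  qed
  ultimately show ?thesis using that[of W r P] MW[OF U(2) assms(2)] retr by blast
qed

context
  fixes M :: "'a::euclidean_space set" and m
  assumes M: "submanifold m M"
begin

lemma subspace_tangent_space: "p \<in> M \<Longrightarrow> subspace (tangent_space M p)"
  and dim_tangent_space: "p \<in> M \<Longrightarrow> dim (tangent_space M p) = m"
  by (atomize(full), safe) (rule submanifold_local[OF M], assumption, blast)+

lemma ext_in_tangent_space: "p \<in> M \<Longrightarrow> ext M v p \<in> tangent_space M p"
  unfolding ext_def by (rule proj_in[OF subspace_tangent_space])

lemma ext_tangent: "p \<in> M \<Longrightarrow> x \<in> tangent_space M p \<Longrightarrow> ext M x p = x"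
  unfolding ext_def by (rule proj_id[OF subspace_tangent_space])

lemma smooth_along_ext: "smooth_along M (ext M v)"
  unfolding smooth_along_def
proof
  fix p assume "p \<in> M"
  from submanifold_local[OF M this] obtain U r P where "p \<in> U" "local_retraction M U r"
    "\<And>v. smooth_on U (\<lambda>q. P q v)"
    "\<And>q. q \<in> U \<Longrightarrow> q \<in> M \<Longrightarrow> P q = proj (tangent_space M q)" by metis
  then show "\<exists>U F. open U \<and> p \<in> U \<and> smooth_on U F \<and> (\<forall>q\<in>U \<inter> M. F q = ext M v q)"
    by (intro exI[of _ U] exI[of _ "\<lambda>q. P q v"]) (auto simp: ext_def local_retraction_def)
qed

lemma proj_eq_sum_ext:
  "p \<in> M \<Longrightarrow> proj (tangent_space M p) v = (\<Sum>b\<in>Basis. (v \<bullet> b) *\<^sub>R ext M b p)"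
  unfolding ext_def by (rule linear_eq_sum_Basis[OF linear_proj[OF subspace_tangent_space]])

lemma smooth_along_proj:
  assumes "smooth_along M V"
  shows "smooth_along M (\<lambda>q. proj (tangent_space M q) (V q))"
proof (rule smooth_along_cong)
  show "smooth_along M (\<lambda>q. \<Sum>b\<in>Basis. (V q \<bullet> b) *\<^sub>R ext M b q)"
    by (intro smooth_along_sum smooth_along_scaleR smooth_along_inner smooth_along_const smooth_along_ext assms)
qed (simp add: proj_eq_sum_ext)

text \<open>Linearity in the extended vector, for arbitrary ambient vectors: this is what
  \<open>trace_on_eq_sum_Basis\<close> asks of the second argument.\<close>

lemma der_ext_linear:
  assumes p: "p \<in> M" and x: "x \<in> tangent_space M p"
  shows "linear (\<lambda>v. der M (ext M v) p x)"
proof (rule linearI)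
  fix v w :: 'a and c :: real
  have "der M (ext M (v + w)) p = der M (\<lambda>q. ext M v q + ext M w q) p"
    by (rule der_cong[OF p]) (simp add: ext_def linear_add[OF linear_proj[OF subspace_tangent_space]])
  then show "der M (ext M (v + w)) p x = der M (ext M v) p x + der M (ext M w) p x"
    by (simp add: der_add[OF p x] smooth_along_ext)
  have "der M (ext M (c *\<^sub>R v)) p = der M (\<lambda>q. c *\<^sub>R ext M v q) p"
    by (rule der_cong[OF p]) (simp add: ext_def linear_cmul[OF linear_proj[OF subspace_tangent_space]])
  then show "der M (ext M (c *\<^sub>R v)) p x = c *\<^sub>R der M (ext M v) p x"
    by (simp add: der_bounded_linear[OF p x bounded_linear_scaleR_right] smooth_along_ext)
qed

end

section \<open>The Laplacian and the maximum principle\<close>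

text \<open>The trace of the Hessian \<open>X (Y u) - (\<nabla>_X Y) u\<close>, evaluated on the
  extensions \<open>ext\<close>. There is no minus sign, in contrast to
  \<open>rough_laplacian\<close>, so the value is nonnegative at a local minimum.\<close>

definition laplacian :: "'a::euclidean_space set \<Rightarrow> ('a \<Rightarrow> real) \<Rightarrow> 'a \<Rightarrow> real" where
  "laplacian M u p = trace_on (tangent_space M p)
     (\<lambda>x y. der M (\<lambda>q. der M u q (ext M y q)) p (ext M x p) - der M u p (cov M M (ext M y) p (ext M x p)))"

context
  fixes M :: "'a::euclidean_space set" and m
  assumes M: "submanifold m M"
begin

lemma smooth_along_der_ext:
  fixes u :: "'a \<Rightarrow> 'b::real_normed_vector"
  shows "smooth_along M u \<Longrightarrow> smooth_along M (\<lambda>q. der M u q (ext M v q))"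
  by (rule smooth_along_der[OF _ smooth_along_ext[OF M] ext_in_tangent_space[OF M]])

lemma onb_tangent: "p \<in> M \<Longrightarrow> e \<in> onb (tangent_space M p) \<Longrightarrow> e \<in> tangent_space M p"
  using onb_subset[OF subspace_tangent_space[OF M]] by blast

lemma laplacian_onb:
  assumes p: "p \<in> M"
  shows "laplacian M u p = (\<Sum>e\<in>onb (tangent_space M p).
    der M (\<lambda>q. der M u q (ext M e q)) p e - der M u p (cov M M (ext M e) p e))"
  unfolding laplacian_def trace_on_onb
  by (rule sum.cong[OF refl]) (simp add: ext_tangent[OF M p onb_tangent[OF p]])

text \<open>Replaces the uncontrolled basis of the tangent space at \<open>p\<close> by the fixed
  ambient one, so that every summand is visibly smooth in \<open>p\<close>.\<close>

lemma laplacian_Basis: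
  assumes p: "p \<in> M" and u: "smooth_along M u"
  shows "laplacian M u p = (\<Sum>b\<in>Basis. der M (\<lambda>q. der M u q (ext M b q)) p (ext M b p)
    - der M u p (proj (tangent_space M p) (der M (ext M b) p (ext M b p))))"
proof -
  let ?T = "tangent_space M p"
  let ?\<beta> = "\<lambda>x y. der M (\<lambda>q. der M u q (ext M y q)) p (ext M x p) - der M u p (cov M M (ext M y) p (ext M x p))"
  note T = subspace_tangent_space[OF M p] and e = ext_tangent[OF M p]
  have lin: "linear (\<lambda>x. der M (\<lambda>q. der M u q (ext M y q)) p x - der M u p (proj ?T (der M (ext M y) p x)))" for y
    by (intro linear_compose_sub linear_compose[OF linear_compose[OF _ linear_proj[OF T]], unfolded o_def]
      linear_der smooth_along_der_ext smooth_along_ext[OF M] u p)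
  have "trace_on ?T ?\<beta> = (\<Sum>b\<in>Basis. ?\<beta> (proj ?T b) b)"
  proof (rule trace_on_eq_sum_Basis[OF T])
    fix x y x' c assume x: "x \<in> ?T" "x' \<in> ?T"
    then have xx': "x + c *\<^sub>R x' \<in> ?T" using T by (intro subspace_add subspace_scale)
    show "?\<beta> (x + c *\<^sub>R x') y = ?\<beta> x y + c *\<^sub>R ?\<beta> x' y"
      using linear_add[OF lin[of y], of x "c *\<^sub>R x'"] linear_cmul[OF lin[of y], of c x']
      unfolding e[OF x(1)] e[OF x(2)] e[OF xx'] cov_def by simp
  next
    fix x assume x: "x \<in> ?T"
    have "linear (\<lambda>y. der M (\<lambda>q. der M u q (ext M y q)) p x)"
    proof (rule linearI)
      fix v w :: 'a and c :: real
      have "der M (\<lambda>q. der M u q (ext M (v + w) q)) p = der M (\<lambda>q. der M u q (ext M v q) + der M u q (ext M w q)) p"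
        by (rule der_cong[OF p])
          (simp add: ext_def linear_add[OF linear_proj[OF subspace_tangent_space[OF M]]] linear_add[OF linear_der[OF u]])
      then show "der M (\<lambda>q. der M u q (ext M (v + w) q)) p x =
        der M (\<lambda>q. der M u q (ext M v q)) p x + der M (\<lambda>q. der M u q (ext M w q)) p x"
        by (simp add: der_add[OF p x] smooth_along_der_ext u)
      have "der M (\<lambda>q. der M u q (ext M (c *\<^sub>R v) q)) p = der M (\<lambda>q. c *\<^sub>R der M u q (ext M v q)) p"
        by (rule der_cong[OF p])
          (simp add: ext_def linear_cmul[OF linear_proj[OF subspace_tangent_space[OF M]]] linear_cmul[OF linear_der[OF u]])
      then show "der M (\<lambda>q. der M u q (ext M (c *\<^sub>R v) q)) p x = c *\<^sub>R der M (\<lambda>q. der M u q (ext M v q)) p x"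
        by (simp add: der_bounded_linear[OF p x bounded_linear_scaleR_right] smooth_along_der_ext u del: real_scaleR_def)
    qed
    then show "linear (?\<beta> x)"
      unfolding e[OF x] cov_def
      by (intro linear_compose_sub linear_compose[OF linear_compose[OF _ linear_proj[OF T]], unfolded o_def]
        linear_der der_ext_linear[OF M] u p x)
  qed
  moreover have "ext M (proj ?T b) p = ext M b p" for b
    unfolding ext_def by (rule proj_id[OF T proj_in[OF T]])
  ultimately show ?thesis unfolding laplacian_def cov_def by simp
qed

lemma smooth_along_laplacian:
  assumes "smooth_along M u"
  shows "smooth_along M (laplacian M u)"
proof (rule smooth_along_cong)
  show "smooth_along M (\<lambda>p. \<Sum>b\<in>Basis. der M (\<lambda>q. der M u q (ext M b q)) p (ext M b p)
    - der M u p (proj (tangent_space M p) (der M (ext M b) p (ext M b p))))"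
    by (intro smooth_along_sum smooth_along_diff smooth_along_der smooth_along_der_ext smooth_along_ext[OF M]
      smooth_along_proj[OF M] ext_in_tangent_space[OF M] proj_in subspace_tangent_space[OF M] assms)
qed (simp add: laplacian_Basis assms)

text \<open>The shape \<open>u + c v\<close> fits all later uses: the barrier
  \<open>s + \<alpha> s^2\<close>, the perturbation of \<open>u\<close> by a multiple of the
  barrier, and the passage from the mean curvature to its negative.\<close>

lemma laplacian_add_cmul:
  assumes p: "p \<in> M" and u: "smooth_along M u" and v: "smooth_along M v"
  shows "laplacian M (\<lambda>q. u q + c * v q) p = laplacian M u p + c * laplacian M v p"
proof -
  have cv: "smooth_along M (\<lambda>q. c * v q)" if "smooth_along M v" for v
    by (rule smooth_along_bounded_linear[OF bounded_linear_mult_right that])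
  have 1: "der M (\<lambda>q. u q + c * v q) q x = der M u q x + c * der M v q x"
    if "q \<in> M" "x \<in> tangent_space M q" "smooth_along M u" "smooth_along M v" for u v q x
    by (simp add: der_add[OF that(1,2,3) cv] der_bounded_linear[OF that(1,2) bounded_linear_mult_right] that)
  have 2: "der M (\<lambda>q. der M (\<lambda>q. u q + c * v q) q (ext M e q)) p =
     der M (\<lambda>q. der M u q (ext M e q) + c * der M v q (ext M e q)) p" for e
    by (rule der_cong[OF p]) (rule 1[OF _ ext_in_tangent_space[OF M] u v])
  note T = subspace_tangent_space[OF M p]
  show ?thesis
    unfolding laplacian_onb[OF p] sum_distrib_left sum.distrib[symmetric] 2
    by (rule sum.cong[OF refl])
      (simp add: 1 p u v onb_tangent smooth_along_der_ext cov_def proj_in[OF T] algebra_simps)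
qed

text \<open>In \<open>\<Delta> (s^2) = 2 s \<Delta> s + 2 |\<nabla> s|^2\<close> the first term
  vanishes where \<open>s\<close> does.\<close>

lemma laplacian_square:
  assumes p: "p \<in> M" and s: "smooth_along M s" "s p = 0"
  shows "laplacian M (\<lambda>q. s q * s q) p = 2 * (\<Sum>e\<in>onb (tangent_space M p). (der M s p e)\<^sup>2)"
proof -
  have 1: "der M (\<lambda>q. s q * s q) q x = 2 * (s q * der M s q x)" if "q \<in> M" "x \<in> tangent_space M q" for q x
    by (simp add: der_mult[OF that s(1,1)])
  have "der M (\<lambda>q. der M (\<lambda>q. s q * s q) q (ext M e q)) p = der M (\<lambda>q. 2 * (s q * der M s q (ext M e q))) p" for e
    by (rule der_cong[OF p]) (rule 1[OF _ ext_in_tangent_space[OF M]])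
  moreover have "der M (\<lambda>q. 2 * (s q * der M s q (ext M e q))) p e = 2 * (der M s p e)\<^sup>2"
    if "e \<in> onb (tangent_space M p)" for e
    using der_bounded_linear[OF p onb_tangent[OF p that] bounded_linear_mult_right, of "\<lambda>q. s q * der M s q (ext M e q)" 2]
    by (simp add: der_mult[OF p onb_tangent[OF p that]] smooth_along_mult smooth_along_der_ext s
      ext_tangent[OF M p onb_tangent[OF p that]] power2_eq_square)
  ultimately show ?thesis
    unfolding laplacian_onb[OF p] sum_distrib_left
    by (intro sum.cong[OF refl])
      (simp add: 1[OF p] s(2) cov_def proj_in[OF subspace_tangent_space[OF M p]])
qed

end

section \<open>The second derivative test at a minimum\<close>

text \<open>If \<open>c\<close> were negative, then \<open>h'\<close> would be negative just to the
  right of 0, where it vanishes, and the mean value theorem would give values below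
  \<open>h 0\<close>. Only differentiability of \<open>h'\<close> at 0 enters.\<close>

lemma second_derivative_local_min:
  fixes h :: "real \<Rightarrow> real"
  assumes "\<delta> > 0" and h: "\<And>t. \<bar>t\<bar> < \<delta> \<Longrightarrow> (h has_real_derivative h' t) (at t)"
    and h': "(h' has_real_derivative c) (at 0)" and min: "\<And>t. \<bar>t\<bar> < \<delta> \<Longrightarrow> h 0 \<le> h t"
  shows "c \<ge> 0"
proof (rule ccontr)
  assume "\<not> c \<ge> 0"
  have h0: "h' 0 = 0"
    by (rule DERIV_local_min[OF h assms(1)]) (use assms(1) min in auto)
  obtain d where d: "d > 0" "\<And>k. k > 0 \<Longrightarrow> k < d \<Longrightarrow> h' k < 0"
    using DERIV_neg_dec_right[OF h'] \<open>\<not> c \<ge> 0\<close> h0 by auto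
  define t where "t = min d \<delta> / 2"
  have t: "t > 0" "t < d" "t < \<delta>" unfolding t_def using d assms(1) by (auto simp: min_def)
  obtain z where z: "0 < z" "z < t" "h t - h 0 = (t - 0) * h' z"
    using MVT2[OF t(1), of h h'] h t by auto
  have "h' z < 0" using d z t by auto
  with t(1) have "t * h' z < 0" by (rule mult_pos_neg)
  with z(3) min[of t] t show False by simp
qed

text \<open>The differential vanishes at a minimum, so the connection term drops out and each
  remaining summand is a second derivative along a straight ambient line, to which the
  one-dimensional test applies.\<close>

lemma laplacian_local_min:
  assumes M: "submanifold m M" and u: "smooth_along M u" and p: "p \<in> M"
    and d: "d > 0" and min: "\<And>q. q \<in> M \<Longrightarrow> dist q p < d \<Longrightarrow> u p \<le> u q"
  shows "laplacian M u p \<ge> 0"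
proof -
  obtain U F where U: "open U" "p \<in> U" "smooth_on U F" "\<And>q. q \<in> U \<Longrightarrow> q \<in> M \<Longrightarrow> F q = u q"
    by (rule smooth_alongE[OF u p]; rule that)
  from submanifold_local[OF M p] obtain U' r where "p \<in> U'" and r: "local_retraction M U' r" by metis
  then have U': "open U'" "p \<in> U'" "smooth_on U' r" "\<And>q. q \<in> U' \<Longrightarrow> r q \<in> M" "\<And>q. q \<in> U' \<Longrightarrow> q \<in> M \<Longrightarrow> r q = q"
    unfolding local_retraction_def by auto
  text \<open>Composing with the retraction turns the local minimum on \<open>M\<close> into one on the ambient space.\<close>
  define W where "W = U' \<inter> r -` (U \<inter> ball p d)"
  define g where "g q = F (r q)" for q
  have "open W"
    unfolding W_def by (intro continuous_open_preimage smooth_on_continuous_on U' open_Int U(1) open_ball)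
  then have W: "open W" "p \<in> W" "W \<subseteq> U'" "r ` W \<subseteq> U"
    unfolding W_def using U U' p d by auto
  have g: "smooth_on W g"
    unfolding g_def by (rule smooth_on_compose[OF W(1) U(1) W(4) smooth_on_subset[OF U'(3) W(3)] U(3)])
  have gu: "g q = u q" if "q \<in> W" "q \<in> M" for q
    unfolding g_def using U'(5)[of q] U(4)[of q] that W(3,4) by (metis image_subset_iff subset_iff)
  have gmin: "g p \<le> g q" if "q \<in> W" for q
  proof -
    have "r q \<in> M" "r q \<in> U" "dist (r q) p < d" using that U'(4) unfolding W_def by (auto simp: dist_commute)
    then show ?thesis using min gu[OF W(2) p] U(4) unfolding g_def by metis
  qed
  let ?g' = "\<lambda>q. frechet_derivative g (at q)"
  have "?g' p = (\<lambda>v. 0)"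
    by (rule differential_zero_maxmin[OF W(2,1) smooth_on_has_derivative[OF g W(2)]]) (use gmin in auto)
  then have g0: "?g' p v = 0" for v by metis
  have ling: "linear (?g' q)" if "q \<in> W" for q
    by (rule has_derivative_linear[OF smooth_on_has_derivative[OF g that]])
  have du: "der M u q x = ?g' q x" if "q \<in> W" "q \<in> M" "x \<in> tangent_space M q" for q x
    by (rule der_extension[OF W(1) that(1,2) g gu that(3)])
  have "der M (\<lambda>q. der M u q (ext M e q)) p e \<ge> 0" if e: "e \<in> tangent_space M p" for e
  proof -
    obtain V E where V: "open V" "p \<in> V" "smooth_on V E" "\<And>q. q \<in> V \<Longrightarrow> q \<in> M \<Longrightarrow> E q = ext M e q"
      by (rule smooth_alongE[OF smooth_along_ext[OF M] p]; rule that)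
    have Ep: "E p = e" using V(4)[OF V(2) p] ext_tangent[OF M p e] by simp
    define g'' where "g'' b = frechet_derivative (\<lambda>q. ?g' q b) (at p)" for b
    have g'': "((\<lambda>q. ?g' q b) has_derivative g'' b) (at p)" for b
      unfolding g''_def by (rule smooth_on_has_derivative[OF smooth_on_frechet_derivative[OF g] W(2)])
    \<comment> \<open>Since \<open>?g' p\<close> is zero, the derivative of the extended vector
      field \<open>E\<close> contributes nothing, and \<open>E\<close> may be frozen at its value at
      \<open>p\<close>.\<close>
    have "((\<lambda>q. \<Sum>b\<in>Basis. (E q \<bullet> b) * ?g' q b) has_derivative (\<lambda>v. \<Sum>b\<in>Basis. (E p \<bullet> b) * g'' b v)) (at p)"
    proof (rule has_derivative_sum)
      fix b :: 'a
      have "((\<lambda>q. (E q \<bullet> b) * ?g' q b) has_derivative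
        (\<lambda>v. (E p \<bullet> b) * g'' b v + (frechet_derivative E (at p) v \<bullet> b) * ?g' p b)) (at p)"
        by (intro has_derivative_mult has_derivative_inner_left smooth_on_has_derivative[OF V(3,2)] g'')
      then show "((\<lambda>q. (E q \<bullet> b) * ?g' q b) has_derivative (\<lambda>v. (E p \<bullet> b) * g'' b v)) (at p)"
        by (simp add: g0)
    qed
    then have "((\<lambda>q. der M u q (ext M e q)) has_derivative (\<lambda>v. \<Sum>b\<in>Basis. (E p \<bullet> b) * g'' b v)) (at p within M)"
    proof (rule has_derivative_within_extension[of "V \<inter> W", rotated 3])
      fix q assume q: "q \<in> V \<inter> W" "q \<in> M"
      have "der M u q (ext M e q) = ?g' q (E q)"
        using q V(4) by (simp add: du ext_in_tangent_space[OF M])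
      then show "(\<Sum>b\<in>Basis. (E q \<bullet> b) * ?g' q b) = der M u q (ext M e q)"
        using linear_eq_sum_Basis[OF ling, of q "E q"] q by simp
    qed (use V W p in auto)
    from der_eqI[OF this e]
    have 1: "der M (\<lambda>q. der M u q (ext M e q)) p e = (\<Sum>b\<in>Basis. (e \<bullet> b) * g'' b e)"
      unfolding Ep .
    have "((\<lambda>q. \<Sum>b\<in>Basis. (e \<bullet> b) * ?g' q b) has_derivative (\<lambda>v. \<Sum>b\<in>Basis. (e \<bullet> b) * g'' b v)) (at p)"
      by (intro has_derivative_sum has_derivative_mult_right g'')
    then have 2: "((\<lambda>q. ?g' q e) has_derivative (\<lambda>v. \<Sum>b\<in>Basis. (e \<bullet> b) * g'' b v)) (at p)"
      by (rule has_derivative_transform_within_open[OF _ W(1,2)])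
        (use linear_eq_sum_Basis[OF ling, of _ e] in simp)
    have line: "((\<lambda>t. p + t *\<^sub>R e) has_derivative (\<lambda>t. t *\<^sub>R e)) (at t)" for t :: real
      by (auto intro!: derivative_eq_intros)
    have "open ((\<lambda>t::real. p + t *\<^sub>R e) -` W)"
      by (intro open_vimage W continuous_intros)
    moreover have "0 \<in> (\<lambda>t::real. p + t *\<^sub>R e) -` W" using W by simp
    ultimately obtain \<delta> where \<delta>: "\<delta> > 0" "ball 0 \<delta> \<subseteq> (\<lambda>t::real. p + t *\<^sub>R e) -` W"
      using open_contains_ball by blast
    then have tW: "p + t *\<^sub>R e \<in> W" if "\<bar>t\<bar> < \<delta>" for t
      using that by (auto simp: subset_iff dist_real_def)
    have "(\<Sum>b\<in>Basis. (e \<bullet> b) * g'' b e) \<ge> 0"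
    proof (rule second_derivative_local_min[OF \<delta>(1)])
      fix t :: real assume t: "\<bar>t\<bar> < \<delta>"
      have "((\<lambda>t. g (p + t *\<^sub>R e)) has_derivative (\<lambda>x. ?g' (p + t *\<^sub>R e) (x *\<^sub>R e))) (at t)"
        by (rule has_derivative_compose[OF line smooth_on_has_derivative[OF g tW[OF t]]])
      then show "((\<lambda>t. g (p + t *\<^sub>R e)) has_real_derivative ?g' (p + t *\<^sub>R e) e) (at t)"
        unfolding has_field_derivative_def linear_cmul[OF ling[OF tW[OF t]]]
        by (simp add: mult.commute[of _ "?g' (p + t *\<^sub>R e) e"])
      show "g (p + 0 *\<^sub>R e) \<le> g (p + t *\<^sub>R e)" using gmin[OF tW[OF t]] by simp
    next
      have "((\<lambda>q. ?g' q e) has_derivative (\<lambda>v. \<Sum>b\<in>Basis. (e \<bullet> b) * g'' b v)) (at (p + 0 *\<^sub>R e))"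
        using 2 by simp
      from has_derivative_compose[OF line this]
      have "((\<lambda>t. ?g' (p + t *\<^sub>R e) e) has_derivative (\<lambda>t. \<Sum>b\<in>Basis. (e \<bullet> b) * g'' b (t *\<^sub>R e))) (at 0)" .
      moreover have "(\<lambda>t. \<Sum>b\<in>Basis. (e \<bullet> b) * g'' b (t *\<^sub>R e)) = (*) (\<Sum>b\<in>Basis. (e \<bullet> b) * g'' b e)"
        by (rule HOL.ext)
          (simp add: linear_cmul[OF has_derivative_linear[OF g'']] sum_distrib_left mult.left_commute mult.commute)
      ultimately show "((\<lambda>t. ?g' (p + t *\<^sub>R e) e) has_real_derivative (\<Sum>b\<in>Basis. (e \<bullet> b) * g'' b e)) (at 0)"
        unfolding has_field_derivative_def by simp
    qed
    then show ?thesis using 1 by simp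
  qed
  moreover have "der M u p x = 0" if "x \<in> tangent_space M p" for x
    using du[OF W(2) p that] g0 by simp
  ultimately show ?thesis
    unfolding laplacian_onb[OF M p] cov_def
    by (intro sum_nonneg) (simp add: onb_tangent[OF M p] proj_in[OF subspace_tangent_space[OF M p]])
qed

section \<open>Hopf's touching ball in the ambient space\<close>

text \<open>The retraction fixes both endpoints, so by the mean value theorem along the ambient
  segment \<open>v \<bullet> v = r'(z) v \<bullet> v\<close> for \<open>v = y - x\<close> and some
  \<open>z\<close> on it. If \<open>v\<close> were normal at \<open>x\<close>, then
  \<open>r'(x) v \<bullet> v = 0\<close>, as \<open>r'(x) v\<close> is tangent; but
  \<open>r'\<close> oscillates by at most one half near \<open>p\<close>.\<close>

lemma submanifold_secant_not_normal:
  fixes M :: "'a::euclidean_space set"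
  assumes M: "submanifold m M" and p: "p \<in> M"
  obtains \<delta> where "\<delta> > 0"
    "\<And>x y. x \<in> M \<Longrightarrow> y \<in> M \<Longrightarrow> dist x p < \<delta> \<Longrightarrow> dist y p < \<delta> \<Longrightarrow> x \<noteq> y \<Longrightarrow> proj (tangent_space M x) (y - x) \<noteq> 0"
proof -
  from submanifold_local[OF M p] obtain U r where pU: "p \<in> U" and r: "local_retraction M U r" by metis
  then have U: "open U" "smooth_on U r" "\<And>q. q \<in> U \<Longrightarrow> q \<in> M \<Longrightarrow> r q = q"
    unfolding local_retraction_def by auto
  let ?r' = "\<lambda>q. frechet_derivative r (at q)"
  have lin: "linear (?r' q)" if "q \<in> U" for q
    by (rule has_derivative_linear[OF smooth_on_has_derivative[OF U(2) that]])
  \<comment> \<open>Two points near \<open>p\<close> then differ by at most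
    \<open>1 / (2 * DIM('a))\<close> on each basis vector, and summing over the basis gives the
    bound \<open>norm v / 2\<close>.\<close>
  have "eventually (\<lambda>q. \<forall>b\<in>Basis. dist (?r' q b) (?r' p b) < 1 / (4 * DIM('a))) (at p)"
  proof (rule eventually_ball_finite[OF finite_Basis], rule ballI)
    fix b :: 'a
    have "((\<lambda>q. ?r' q b) \<longlongrightarrow> ?r' p b) (at p)"
      using smooth_on_continuous_on[OF smooth_on_frechet_derivative[OF U(2)]] U(1) pU
      by (simp add: continuous_on_eq_continuous_at isCont_def)
    then show "eventually (\<lambda>q. dist (?r' q b) (?r' p b) < 1 / (4 * DIM('a))) (at p)"
      by (rule tendstoD) simp
  qed
  then obtain d1 where d1: "d1 > 0" "\<And>q b. q \<noteq> p \<Longrightarrow> dist q p < d1 \<Longrightarrow> b \<in> Basis \<Longrightarrow> dist (?r' q b) (?r' p b) < 1 / (4 * DIM('a))"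
    unfolding eventually_at by auto
  obtain d2 where d2: "d2 > 0" "ball p d2 \<subseteq> U" using U pU open_contains_ball by blast
  define \<delta> where "\<delta> = min d1 d2"
  have \<delta>: "\<delta> > 0" "ball p \<delta> \<subseteq> U" unfolding \<delta>_def using d1 d2 by auto
  have near: "dist (?r' q b) (?r' p b) < 1 / (4 * DIM('a))" if "q \<in> ball p \<delta>" "b \<in> Basis" for q b
    using d1(2)[of q b] that unfolding \<delta>_def by (cases "q = p") (auto simp: dist_commute)
  have osc: "norm (?r' z v - ?r' x v) \<le> norm v / 2" if x: "x \<in> ball p \<delta>" and z: "z \<in> ball p \<delta>" for x z v
  proof -
    have "?r' z v - ?r' x v = (\<Sum>b\<in>Basis. (v \<bullet> b) *\<^sub>R (?r' z b - ?r' x b))"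
      using linear_eq_sum_Basis[OF lin, of z v] linear_eq_sum_Basis[OF lin, of x v] x z \<delta>(2)
      by (simp add: subset_iff scaleR_diff_right sum_subtractf)
    also have "norm \<dots> \<le> (\<Sum>b\<in>(Basis::'a set). norm v * (1 / (2 * DIM('a))))"
    proof (rule sum_norm_le)
      fix b :: 'a assume b: "b \<in> Basis"
      have "dist (?r' z b) (?r' x b) \<le> 1 / (2 * DIM('a))"
        using near[OF x b] near[OF z b] dist_triangle2[of "?r' z b" "?r' x b" "?r' p b"] by simp
      then show "norm ((v \<bullet> b) *\<^sub>R (?r' z b - ?r' x b)) \<le> norm v * (1 / (2 * DIM('a)))"
        unfolding norm_scaleR dist_norm[symmetric] using Basis_le_norm[OF b, of v]
        by (intro mult_mono) auto
    qed
    also have "\<dots> = norm v / 2" by simp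
    finally show ?thesis .
  qed
  show thesis
  proof (rule that[OF \<delta>(1)])
    fix x y assume xy: "x \<in> M" "y \<in> M" "dist x p < \<delta>" "dist y p < \<delta>" "x \<noteq> y"
    then have b: "x \<in> ball p \<delta>" "y \<in> ball p \<delta>" by (auto simp: dist_commute)
    then have xyU: "x \<in> U" "y \<in> U" using \<delta>(2) by auto
    define v where "v = y - x"
    have seg: "x + t *\<^sub>R v \<in> ball p \<delta>" if "0 \<le> t" "t \<le> 1" for t
    proof -
      have "x + t *\<^sub>R v = (1 - t) *\<^sub>R x + t *\<^sub>R y" unfolding v_def by (simp add: algebra_simps)
      then show ?thesis using convexD[OF convex_ball b, of "1 - t" t] that by simp
    qed
    have line: "((\<lambda>t. x + t *\<^sub>R v) has_derivative (\<lambda>t. t *\<^sub>R v)) (at t)" for t :: real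
      by (auto intro!: derivative_eq_intros)
    have "((\<lambda>t. r (x + t *\<^sub>R v) \<bullet> v) has_real_derivative ?r' (x + t *\<^sub>R v) v \<bullet> v) (at t)"
      if "0 \<le> t" "t \<le> 1" for t
    proof -
      have U': "x + t *\<^sub>R v \<in> U" using seg[OF that] \<delta>(2) by blast
      have "((\<lambda>t. r (x + t *\<^sub>R v) \<bullet> v) has_derivative (\<lambda>s. ?r' (x + t *\<^sub>R v) (s *\<^sub>R v) \<bullet> v)) (at t)"
        by (rule has_derivative_inner_left[OF has_derivative_compose[OF line smooth_on_has_derivative[OF U(2) U']]])
      then show ?thesis
        unfolding has_field_derivative_def linear_cmul[OF lin[OF U']]
        by (simp add: mult.commute[of _ "?r' (x + t *\<^sub>R v) v \<bullet> v"])
    qed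
    from MVT2[of 0 1 "\<lambda>t. r (x + t *\<^sub>R v) \<bullet> v", OF _ this]
    obtain t where t: "0 < t" "t < 1" "r (x + v) \<bullet> v - r x \<bullet> v = ?r' (x + t *\<^sub>R v) v \<bullet> v" by auto
    then have 1: "v \<bullet> v = ?r' (x + t *\<^sub>R v) v \<bullet> v"
      using U(3)[OF xyU(1) xy(1)] U(3)[OF xyU(2) xy(2)] unfolding v_def by (simp add: inner_diff_left)
    show "proj (tangent_space M x) (y - x) \<noteq> 0"
    proof
      assume "proj (tangent_space M x) (y - x) = 0"
      moreover have "?r' x v \<in> tangent_space M x"
        using tangent_space_local_retraction[OF r xyU(1) xy(1)] by blast
      ultimately have "v \<bullet> ?r' x v = 0"
        using inner_proj[OF subspace_tangent_space[OF M xy(1)], of "?r' x v" v] unfolding v_def by simp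
      then have "v \<bullet> v = (?r' (x + t *\<^sub>R v) v - ?r' x v) \<bullet> v"
        using 1 by (simp add: inner_diff_left inner_commute[of "?r' x v"])
      also have "\<dots> \<le> norm (?r' (x + t *\<^sub>R v) v - ?r' x v) * norm v" by (rule norm_cauchy_schwarz)
      also have "\<dots> \<le> norm v / 2 * norm v"
        by (intro mult_right_mono osc b seg) (use t in auto)
      also have "\<dots> = v \<bullet> v / 2" by (simp add: dot_square_norm power2_eq_square)
      finally show False using xy(5) inner_gt_zero_iff[of v] unfolding v_def by simp
    qed
  qed
qed


text \<open>By connectedness \<open>Z\<close> is not open in \<open>M\<close>, so points of
  \<open>M - Z\<close> accumulate at some \<open>p\<close> in \<open>Z\<close>. If \<open>q\<close>
  is one of them within \<open>\<delta> / 2\<close> of \<open>p\<close>, its nearest point in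
  \<open>Z\<close> is within \<open>\<delta>\<close> of \<open>p\<close>, and the secant lemma
  applies to the two.\<close>

lemma tangential_closest_point:
  fixes M :: "'a::euclidean_space set"
  assumes M: "submanifold m M" and "connected M" "closedin (top_of_set M) Z" "compact Z" "Z \<noteq> {}" "Z \<noteq> M"
  obtains q z where "q \<in> M" "q \<notin> Z" "z \<in> Z" "\<And>x. x \<in> Z \<Longrightarrow> dist q z \<le> dist q x"
    "proj (tangent_space M z) (q - z) \<noteq> 0"
proof -
  have ZM: "Z \<subseteq> M" using assms(3) closedin_subset by fastforce
  have "\<not> openin (top_of_set M) Z"
    using assms unfolding connected_clopen by blast
  then obtain p where p: "p \<in> Z" "\<And>e. e > 0 \<Longrightarrow> \<exists>q\<in>M. dist q p < e \<and> q \<notin> Z"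
    using ZM unfolding openin_euclidean_subtopology_iff by metis
  then have "p \<in> M" using ZM by blast
  obtain \<delta> where \<delta>: "\<delta> > 0"
    "\<And>x y. x \<in> M \<Longrightarrow> y \<in> M \<Longrightarrow> dist x p < \<delta> \<Longrightarrow> dist y p < \<delta> \<Longrightarrow> x \<noteq> y \<Longrightarrow> proj (tangent_space M x) (y - x) \<noteq> 0"
    using submanifold_secant_not_normal[OF M \<open>p \<in> M\<close>] by metis
  obtain q where q: "q \<in> M" "q \<notin> Z" "dist q p < \<delta> / 2" using p(2)[of "\<delta> / 2"] \<delta>(1) by auto
  obtain z where z: "z \<in> Z" "\<And>x. x \<in> Z \<Longrightarrow> dist q z \<le> dist q x"
    using distance_attains_inf[OF compact_imp_closed[OF assms(4)] assms(5)] by metis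
  have "dist z p \<le> dist q z + dist q p" using dist_triangle3[of z p q] by (simp add: dist_commute)
  then have "dist z p < \<delta>" using z(2)[OF p(1)] q(3) by simp
  moreover have "dist q p < \<delta>" using q(3) \<delta>(1) by simp
  moreover have "z \<noteq> q" using z q by blast
  ultimately have "proj (tangent_space M z) (q - z) \<noteq> 0"
    using \<delta>(2) z(1) q(1) ZM by blast
  with that q z show thesis by blast
qed

text \<open>The ball with diameter from \<open>q\<close> to \<open>z\<close> lies in the ball about
  \<open>q\<close> through \<open>z\<close> and meets its boundary only at \<open>z\<close>. With
  the midpoint as origin, the parallelogram law bounds \<open>|a - w|^2\<close> by
  \<open>2 |a|^2 + 2 |w|^2 - 4 |w|^2\<close>, which is at most 0.\<close>

lemma internally_tangent_sphere:
  fixes q z x :: "'a::real_inner"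
  assumes "dist q z \<le> dist q x" and "dist (midpoint q z) x \<le> dist (midpoint q z) z"
  shows "x = z"
proof -
  define a w where "a = x - midpoint q z" and "w = z - midpoint q z"
  have q: "q - midpoint q z = - w" unfolding w_def midpoint_def by (simp add: algebra_simps flip: scaleR_add_left)
  have "q - z = - 2 *\<^sub>R w" "q - x = - w - a"
    using q unfolding w_def a_def by (simp_all add: algebra_simps scaleR_2)
  then have "norm (2 *\<^sub>R w) \<le> norm (w + a)"
    using assms(1) by (simp add: dist_norm norm_minus_commute[of "- w" a] add.commute)
  then have "(2 *\<^sub>R w) \<bullet> (2 *\<^sub>R w) \<le> (w + a) \<bullet> (w + a)" by (simp only: norm_le)
  moreover have "norm a \<le> norm w" using assms(2) unfolding a_def w_def by (simp add: dist_norm norm_minus_commute)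
  then have "a \<bullet> a \<le> w \<bullet> w" by (simp only: norm_le)
  ultimately have "(a - w) \<bullet> (a - w) \<le> 0"
    by (simp add: inner_add_left inner_add_right inner_diff_left inner_diff_right inner_commute)
  then have "a = w" by (metis inner_gt_zero_iff not_less right_minus_eq)
  then show ?thesis unfolding a_def w_def by simp
qed

text \<open>Hopf's argument: if the set \<open>Z\<close> of minima is proper, a ball touches it from outside
  at a single point \<open>z\<close>, not orthogonally to \<open>M\<close>. A polynomial \<open>\<phi>\<close> of the distance to the centre of
  the ball is then subharmonic near \<open>z\<close> and positive only inside the ball, and \<open>u - \<epsilon> \<phi>\<close> has an interior
  minimum near \<open>z\<close>.\<close>

theorem superharmonic_constant_on:
  fixes M :: "'a::euclidean_space set"
  assumes M: "submanifold m M" and conn: "connected M" and comp: "compact M"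
    and u: "smooth_along M u" and super: "\<And>p. p \<in> M \<Longrightarrow> laplacian M u p \<le> 0"
  shows "u constant_on M"
proof (cases "M = {}")
  case False
  note cu = smooth_along_continuous_on[OF u]
  obtain p0 where p0: "p0 \<in> M" "\<And>q. q \<in> M \<Longrightarrow> u p0 \<le> u q"
    using continuous_attains_inf[OF comp False cu] by blast
  define Z where "Z = {q\<in>M. u q = u p0}"
  have "Z = M \<inter> u -` {u p0}" unfolding Z_def by auto
  then have Zc: "closedin (top_of_set M) Z" using continuous_closedin_preimage[OF cu] by simp
  then have Zcomp: "compact Z" using comp closedin_compact by blast
  have "Z = M"
  proof (rule ccontr)
    assume "Z \<noteq> M"
    moreover have "Z \<noteq> {}" using p0 unfolding Z_def by auto
    ultimately obtain q0 z where q0: "q0 \<in> M" "q0 \<notin> Z" and z: "z \<in> Z"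
      and near: "\<And>x. x \<in> Z \<Longrightarrow> dist q0 z \<le> dist q0 x"
      and nn: "proj (tangent_space M z) (q0 - z) \<noteq> 0"
      using tangential_closest_point[OF M conn Zc Zcomp] by metis
    have zM: "z \<in> M" and uz: "u z = u p0" using z unfolding Z_def by auto
    \<comment> \<open>The ball about \<open>q0\<close> through \<open>z\<close> could touch
      \<open>Z\<close> in several points; the ball of half the radius touches it in \<open>z\<close>
      alone.\<close>
    define c where "c = midpoint q0 z"
    define s where "s x = (z - c) \<bullet> (z - c) - (x - c) \<bullet> (x - c)" for x
    have s0: "s z = 0" unfolding s_def by simp
    have touch: "x = z" if "x \<in> Z" "s x \<ge> 0" for x
      by (rule internally_tangent_sphere[OF near[OF that(1)]])
        (use that(2) in \<open>simp add: s_def c_def dist_norm norm_minus_commute[of "midpoint q0 z"] norm_le\<close>)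
    have smxc: "smooth_along M (\<lambda>x. x - c)"
      by (intro smooth_along_diff smooth_along_ident smooth_along_const)
    have s: "smooth_along M s"
      unfolding s_def by (intro smooth_along_diff smooth_along_const smooth_along_inner smxc)
    define T where "T = tangent_space M z"
    have subT: "subspace T" unfolding T_def by (rule subspace_tangent_space[OF M zM])
    have ds: "der M s z x = (q0 - z) \<bullet> x" if "x \<in> T" for x
    proof -
      have "(s has_derivative (\<lambda>v. - (2 * ((z - c) \<bullet> v)))) (at z within M)"
        unfolding s_def by (auto intro!: derivative_eq_intros simp: inner_commute)
      then have "der M s z x = - (2 * ((z - c) \<bullet> x))" using that unfolding T_def by (rule der_eqI)
      moreover have "2 *\<^sub>R (z - c) = z - q0" unfolding c_def midpoint_def by (simp add: algebra_simps scaleR_2)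
      ultimately show ?thesis by (metis inner_minus_left inner_scaleR_left minus_diff_eq)
    qed
    define K where "K = (\<Sum>e\<in>onb T. (der M s z e)\<^sup>2)"
    have "K > 0"
    proof (rule ccontr)
      assume "\<not> K > 0"
      then have "K = 0" unfolding K_def by (smt (verit) sum_nonneg zero_le_power2)
      then have "(q0 - z) \<bullet> e = 0" if "e \<in> onb T" for e
        using that ds[of e] onb_subset[OF subT] unfolding K_def
        by (subst (asm) sum_nonneg_eq_0_iff) (auto simp: finite_onb[OF subT])
      then have "proj T (q0 - z) = 0" by (simp add: proj_onb[OF subT])
      then show False using nn unfolding T_def by simp
    qed
    \<comment> \<open>At \<open>z\<close> the Laplacian of \<open>s^2\<close> equals
      \<open>2 * K\<close> with \<open>K = |\<nabla> s|^2\<close>, so this choice adds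
      \<open>|\<Delta> s| + 1\<close> to \<open>\<Delta> s\<close> and makes the sum
      positive.\<close>
    define \<alpha> where "\<alpha> = (\<bar>laplacian M s z\<bar> + 1) / (2 * K)"
    have "\<alpha> > 0" unfolding \<alpha>_def using \<open>K > 0\<close> by (intro divide_pos_pos) auto
    define \<phi> where "\<phi> x = s x + \<alpha> * (s x * s x)" for x
    have ss: "smooth_along M (\<lambda>x. s x * s x)" by (intro smooth_along_mult s)
    have \<phi>: "smooth_along M \<phi>"
      unfolding \<phi>_def by (intro smooth_along_add s smooth_along_mult smooth_along_const)
    have "laplacian M \<phi> z = laplacian M s z + \<alpha> * (2 * K)"
      unfolding \<phi>_def laplacian_add_cmul[OF M zM s ss] laplacian_square[OF M zM s s0] K_def T_def ..
    also have "\<alpha> * (2 * K) = \<bar>laplacian M s z\<bar> + 1" unfolding \<alpha>_def using \<open>K > 0\<close> by simp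
    finally have "laplacian M \<phi> z > 0" by simp
    then obtain d1 where "d1 > 0"
      "\<And>x. x \<in> M \<Longrightarrow> dist x z < d1 \<Longrightarrow> \<bar>laplacian M \<phi> x - laplacian M \<phi> z\<bar> < laplacian M \<phi> z"
      using smooth_along_continuous_on[OF smooth_along_laplacian[OF M \<phi>]] zM
      unfolding continuous_on_iff dist_real_def by meson
    then have d1: "d1 > 0" "\<And>x. x \<in> M \<Longrightarrow> dist x z < d1 \<Longrightarrow> laplacian M \<phi> x > 0"
      by (auto simp: abs_diff_less_iff)
    have "continuous_on M (\<lambda>x. 1 + \<alpha> * s x)"
      by (intro continuous_intros smooth_along_continuous_on[OF s])
    \<comment> \<open>As \<open>s z = 0\<close>, the factor in
      \<open>\<phi> = s (1 + \<alpha> s)\<close> stays positive near \<open>z\<close>, so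
      \<open>\<phi>\<close> has the sign of \<open>s\<close> there.\<close>
    then obtain d2 where d2: "d2 > 0" "\<And>x. x \<in> M \<Longrightarrow> dist x z < d2 \<Longrightarrow> \<bar>(1 + \<alpha> * s x) - (1 + \<alpha> * s z)\<bar> < 1"
      using zM zero_less_one unfolding continuous_on_iff dist_real_def by meson
    define d where "d = min d1 d2 / 2"
    have d: "d > 0" "d < d1" "d < d2" unfolding d_def using d1(1) d2(1) by (auto simp: min_def)
    define C where "C = M \<inter> cball z d"
    have C: "compact C" "z \<in> C" "C \<subseteq> M"
      unfolding C_def using comp d zM by (auto intro: compact_Int_closed)
    have \<phi>neg: "\<phi> x < 0" if "x \<in> C" "s x < 0" for x
    proof -
      have "1 + \<alpha> * s x > 0" using d2(2)[of x] that d s0 unfolding C_def by (auto simp: dist_commute)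
      then have "s x * (1 + \<alpha> * s x) < 0" using that by (intro mult_neg_pos)
      then show ?thesis unfolding \<phi>_def by (simp add: algebra_simps)
    qed
    have c\<phi>: "continuous_on C \<phi>" and cuC: "continuous_on C u" and cs: "continuous_on C s"
      using smooth_along_continuous_on continuous_on_subset C(3) \<phi> u s by blast+
    obtain B where B: "B > 0" "\<And>x. x \<in> C \<Longrightarrow> \<phi> x \<le> B"
    proof -
      obtain y where "\<And>x. x \<in> C \<Longrightarrow> \<phi> x \<le> \<phi> y"
        using continuous_attains_sup[OF C(1) _ c\<phi>] C(2) by blast
      then show ?thesis by (intro that[of "max 1 (\<phi> y)"]) (auto simp: le_max_iff_disj)
    qed
    \<comment> \<open>The points at distance \<open>d\<close> from \<open>z\<close> at which
      \<open>\<phi>\<close> may fail to be negative. This compact set misses \<open>Z\<close>, since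
      \<open>touch\<close> leaves only \<open>z\<close> itself, so \<open>u\<close> exceeds its
      minimum on it by a uniform \<open>\<eta>\<close>.\<close>
    define D where "D = {x\<in>C. dist x z = d \<and> s x \<ge> 0}"
    have "D = C \<inter> (sphere z d \<inter> (C \<inter> s -` {0..}))" unfolding D_def by (auto simp: dist_commute)
    moreover have DC: "D \<subseteq> C" unfolding D_def by blast
    moreover have "closed (C \<inter> s -` {0..})"
      by (rule continuous_closed_preimage[OF cs compact_imp_closed[OF C(1)]]) simp
    ultimately have Dcomp: "compact D" using C(1) by (metis closed_Int closed_sphere compact_Int_closed)
    obtain \<eta> where \<eta>: "\<eta> > 0" "\<And>x. x \<in> D \<Longrightarrow> u x \<ge> u p0 + \<eta>"
    proof (cases "D = {}")
      case True
      then show ?thesis using that[of 1] by auto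
    next
      case False
      obtain y where y: "y \<in> D" "\<And>x. x \<in> D \<Longrightarrow> u y \<le> u x"
        using continuous_attains_inf[OF Dcomp False continuous_on_subset[OF cuC DC]] by blast
      have "y \<noteq> z" "y \<in> M" "s y \<ge> 0" using y(1) d C unfolding D_def by auto
      then have "u y \<noteq> u p0" using touch unfolding Z_def by auto
      then have "u y > u p0" using p0(2)[OF \<open>y \<in> M\<close>] by simp
      then show ?thesis using that[of "u y - u p0"] y(2) by auto
    qed
    \<comment> \<open>Small enough that \<open>\<epsilon> \<phi>\<close> is at most
      \<open>\<eta> / 2\<close> on \<open>C\<close> and so cannot use up the gain on
      \<open>D\<close>.\<close>
    define \<epsilon> where "\<epsilon> = \<eta> / (2 * B)"
    have \<epsilon>: "\<epsilon> > 0" unfolding \<epsilon>_def using \<eta> B by simp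
    define w where "w x = u x + (- \<epsilon>) * \<phi> x" for x
    have cw: "continuous_on C w" unfolding w_def by (intro continuous_intros cuC c\<phi>)
    obtain p where p: "p \<in> C" "\<And>x. x \<in> C \<Longrightarrow> w p \<le> w x"
      using continuous_attains_inf[OF C(1) _ cw] C(2) by blast
    have wz: "w z = u p0" unfolding w_def \<phi>_def using s0 uz by simp
    have bd: "w x > u p0" if x: "x \<in> C" "dist x z = d" for x
    proof (cases "s x \<ge> 0")
      case True
      then have "u x \<ge> u p0 + \<eta>" using \<eta>(2) x unfolding D_def by auto
      moreover have "\<epsilon> * \<phi> x \<le> \<epsilon> * B" using B(2)[OF x(1)] \<epsilon> by simp
      moreover have "\<epsilon> * B = \<eta> / 2" unfolding \<epsilon>_def using B(1) by simp
      ultimately show ?thesis unfolding w_def using \<eta>(1) by simp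
    next
      case False
      then have "\<epsilon> * \<phi> x < 0" using \<phi>neg[OF x(1)] \<epsilon> by (intro mult_pos_neg) auto
      then show ?thesis unfolding w_def using p0(2)[of x] x C(3) by auto
    qed
    \<comment> \<open>The value of \<open>w\<close> at \<open>z\<close> is already below all its
      values at distance \<open>d\<close>, so a minimum over \<open>C\<close> is attained
      inside.\<close>
    have pd: "dist p z < d"
      using bd[OF p(1)] p(2)[OF C(2)] wz p(1) unfolding C_def by (force simp: dist_commute)
    have pM: "p \<in> M" using p C by blast
    have "laplacian M w p \<ge> 0"
    proof (rule laplacian_local_min[OF M _ pM, of w "d - dist p z"])
      show "smooth_along M w"
        unfolding w_def by (intro smooth_along_add u smooth_along_mult smooth_along_const \<phi>)
      fix q assume q: "q \<in> M" "dist q p < d - dist p z"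
      then have "dist q z < d" using dist_triangle[of q z p] by simp
      then show "w p \<le> w q" using p(2) q unfolding C_def by (auto simp: dist_commute)
    qed (use pd in simp)
    moreover have "laplacian M w p = laplacian M u p - \<epsilon> * laplacian M \<phi> p"
      unfolding w_def using laplacian_add_cmul[OF M pM u \<phi>, of "- \<epsilon>"] by simp
    moreover have "\<epsilon> * laplacian M \<phi> p > 0" using d1(2)[OF pM] pd d(2) \<epsilon> by simp
    ultimately show False using super[OF pM] by simp
  qed
  then show ?thesis unfolding Z_def constant_on_def by blast
qed (simp add: constant_on_def)

section \<open>Submanifolds of the unit sphere\<close>

lemma tangent_sphere_subset:
  assumes M: "M \<subseteq> sphere 0 1" and p: "p \<in> M" and x: "x \<in> tangent_space M p"
  shows "x \<bullet> p = 0"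
proof -
  have "der M (\<lambda>q. q \<bullet> q) p = der M (\<lambda>q. 1) p"
    by (rule der_cong[OF p]) (use M in \<open>auto simp: dot_square_norm\<close>)
  then show ?thesis
    using der_inner[OF p x smooth_along_ident smooth_along_ident]
    by (simp add: der_const[OF x] der_ident[OF x] inner_commute)
qed

lemma local_retraction_sphere:
  "local_retraction (sphere 0 1 :: 'a::euclidean_space set) (- {0}) (\<lambda>y. inverse (norm y) *\<^sub>R y)"
  unfolding local_retraction_def
proof (intro conjI)
  show "smooth_on (- {0}) (\<lambda>y::'a. inverse (norm y) *\<^sub>R y)"
    by (intro smooth_on_bilinear[OF _ bounded_bilinear_scaleR] smooth_on_inverse smooth_on_norm smooth_on_ident) auto
  show "(\<lambda>y::'a. inverse (norm y) *\<^sub>R y) ` (- {0}) \<subseteq> (- {0}) \<inter> sphere 0 1"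
  proof (rule image_subsetI)
    fix y :: 'a assume "y \<in> - {0}"
    then show "inverse (norm y) *\<^sub>R y \<in> (- {0}) \<inter> sphere 0 1" by simp
  qed
qed auto

text \<open>The derivative at \<open>p\<close> of the radial retraction sends \<open>v\<close> to
  \<open>v - (p \<bullet> v) p\<close> and hence fixes every vector orthogonal to \<open>p\<close>;
  such vectors are therefore tangent.\<close>

lemma tangent_space_sphere:
  fixes p :: "'a::euclidean_space"
  assumes p: "p \<in> sphere 0 1"
  shows "tangent_space (sphere 0 1) p = {x. x \<bullet> p = 0}"
proof
  show "tangent_space (sphere 0 1) p \<subseteq> {x. x \<bullet> p = 0}"
    using tangent_sphere_subset[OF subset_refl p] by blast
  have p0: "p \<noteq> 0" "p \<bullet> p = 1" using p by (auto simp: dot_square_norm)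
  show "{x. x \<bullet> p = 0} \<subseteq> tangent_space (sphere 0 1) p"
  proof
    fix x assume "x \<in> {x. x \<bullet> p = 0}"
    then have x: "x \<bullet> p = 0" by simp
    have "((\<lambda>y. inverse (sqrt (y \<bullet> y)) *\<^sub>R y) has_derivative
       (\<lambda>v. inverse (sqrt (p \<bullet> p)) *\<^sub>R v - (p \<bullet> v) *\<^sub>R p)) (at p)"
      by (auto intro!: derivative_eq_intros simp: p0 inner_commute)
    from frechet_derivative_at[OF this]
    have "frechet_derivative (\<lambda>y. inverse (norm y) *\<^sub>R y) (at p) = (\<lambda>v. inverse (sqrt (p \<bullet> p)) *\<^sub>R v - (p \<bullet> v) *\<^sub>R p)"
      unfolding norm_eq_sqrt_inner by simp
    then have "frechet_derivative (\<lambda>y. inverse (norm y) *\<^sub>R y) (at p) x = x"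
      using x p0 by (simp add: inner_commute[of p x])
    then show "x \<in> tangent_space (sphere 0 1) p"
      using tangent_space_local_retraction[OF local_retraction_sphere _ p] p0 by (metis ComplI rangeI singletonD)
  qed
qed

lemma subspace_tangent_space_sphere: "p \<in> sphere 0 1 \<Longrightarrow> subspace (tangent_space (sphere 0 1) p)"
  by (simp only: tangent_space_sphere) (auto intro!: subspaceI simp: inner_add_left)

lemma proj_tangent_space_sphere:
  fixes p :: "'a::euclidean_space"
  assumes p: "p \<in> sphere 0 1"
  shows "proj (tangent_space (sphere 0 1) p) v = v - (v \<bullet> p) *\<^sub>R p"
  by (rule proj_eqI[OF subspace_tangent_space_sphere[OF p]])
    (use p in \<open>auto simp: tangent_space_sphere[OF p] inner_diff_left dot_square_norm inner_commute[of p]\<close>)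

lemma cov_sphere:
  "p \<in> sphere 0 1 \<Longrightarrow> cov (sphere 0 1) M V p x = der M V p x - (der M V p x \<bullet> p) *\<^sub>R p"
  unfolding cov_def by (rule proj_tangent_space_sphere)

text \<open>The extension \<open>ext N v\<close> is the field \<open>v - (v \<bullet> q) q\<close>,
  the gradient of a height function, whose covariant derivative along \<open>w\<close> is just
  \<open>- (v \<bullet> q) w\<close>. At \<open>p\<close> all three vectors are orthogonal to
  \<open>p\<close>, so the bracket vanishes and a second covariant derivative sees only the
  derivative of the factor \<open>z \<bullet> q\<close>.\<close>

lemma curvature_sphere:
  fixes p :: "'a::euclidean_space"
  defines "N \<equiv> sphere (0::'a) 1"
  assumes p: "p \<in> N" and x: "x \<bullet> p = 0" and y: "y \<bullet> p = 0" and z: "z \<bullet> p = 0"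
  shows "curvature N p x y z = (z \<bullet> y) *\<^sub>R x - (z \<bullet> x) *\<^sub>R y"
proof -
  have ext: "ext N v q = v - (v \<bullet> q) *\<^sub>R q" if "q \<in> N" for v q
    using that unfolding ext_def N_def by (rule proj_tangent_space_sphere)
  have T: "w \<in> tangent_space N q \<longleftrightarrow> w \<bullet> q = 0" if "q \<in> N" for w q
    using that unfolding N_def by (simp only: tangent_space_sphere mem_Collect_eq)
  have qq: "q \<bullet> q = 1" if "q \<in> N" for q using that unfolding N_def by (simp add: dot_square_norm)
  have der: "der N (ext N v) q w = - ((v \<bullet> q) *\<^sub>R w + (v \<bullet> w) *\<^sub>R q)" if q: "q \<in> N" "w \<bullet> q = 0" for v q w
  proof -
    have "der N (ext N v) q = der N (\<lambda>q. v - (v \<bullet> q) *\<^sub>R q) q"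
      by (rule der_cong[OF q(1)]) (rule ext)
    moreover have "((\<lambda>q. v - (v \<bullet> q) *\<^sub>R q) has_derivative (\<lambda>w. - ((v \<bullet> q) *\<^sub>R w + (v \<bullet> w) *\<^sub>R q))) (at q within N)"
      by (auto intro!: derivative_eq_intros)
    ultimately show ?thesis using T[OF q(1)] q(2) by (simp add: der_eqI)
  qed
  have cov: "cov N N (ext N v) q w = - ((v \<bullet> q) *\<^sub>R w)" if "q \<in> N" "w \<bullet> q = 0" for v q w
    using cov_sphere[of q N "ext N v" w] that qq[OF that(1)] unfolding N_def[symmetric]
    by (simp add: der inner_add_left inner_diff_left)
  have tang: "ext N v q \<bullet> q = 0" if "q \<in> N" for v q
    using qq that by (simp add: ext inner_diff_left)
  have cov2: "cov N N (\<lambda>q. cov N N (ext N z) q (ext N y q)) p x = - ((z \<bullet> x) *\<^sub>R y)"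
    if x: "x \<bullet> p = 0" and y: "y \<bullet> p = 0" for x y
  proof -
    have "der N (\<lambda>q. cov N N (ext N z) q (ext N y q)) p = der N (\<lambda>q. - ((z \<bullet> q) *\<^sub>R (y - (y \<bullet> q) *\<^sub>R q))) p"
      by (rule der_cong[OF p]) (use cov ext tang in auto)
    moreover have "((\<lambda>q. - ((z \<bullet> q) *\<^sub>R (y - (y \<bullet> q) *\<^sub>R q))) has_derivative
      (\<lambda>w. - ((z \<bullet> p) *\<^sub>R (- ((y \<bullet> p) *\<^sub>R w + (y \<bullet> w) *\<^sub>R p)) + (z \<bullet> w) *\<^sub>R (y - (y \<bullet> p) *\<^sub>R p)))) (at p within N)"
      by (auto intro!: derivative_eq_intros)
    ultimately have "der N (\<lambda>q. cov N N (ext N z) q (ext N y q)) p x = - ((z \<bullet> x) *\<^sub>R y)"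
      using T[OF p] x y z by (simp add: der_eqI)
    then show ?thesis using p y unfolding N_def by (simp only: cov_sphere) simp
  qed
  have "ext N x p = x" "ext N y p = y" using ext[OF p] x y by auto
  then have "lie_bracket N (ext N x) (ext N y) p = 0"
    unfolding lie_bracket_def by (simp add: der[OF p x] der[OF p y] x y inner_commute[of x y])
  then show ?thesis
    unfolding curvature_def curvature_field_def \<open>ext N x p = x\<close> \<open>ext N y p = y\<close>
    by (simp add: cov2 x y cov[OF p])
qed

section \<open>The mean curvature vector of a submanifold of the sphere\<close>

context
  fixes M :: "'a::euclidean_space set" and m :: nat
  assumes M: "submanifold m M" and sphere: "M \<subseteq> sphere 0 1"
begin

private abbreviation "H \<equiv> mean_curvature_vector (sphere 0 1) m M"
private abbreviation "f \<equiv> mean_curvature (sphere 0 1) m M"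
private abbreviation "\<xi> \<equiv> unit_mean_curvature_vector (sphere 0 1) m M"
private abbreviation "T \<equiv> tangent_space M"

private lemma subT: "p \<in> M \<Longrightarrow> subspace (T p)"
  by (rule subspace_tangent_space[OF M])

private lemma tangent_radial: "p \<in> M \<Longrightarrow> x \<in> T p \<Longrightarrow> x \<bullet> p = 0"
  by (rule tangent_sphere_subset[OF sphere])

private lemma cov_M: "p \<in> M \<Longrightarrow> cov (sphere 0 1) M V p x = der M V p x - (der M V p x \<bullet> p) *\<^sub>R p"
  using sphere by (intro cov_sphere) auto

private lemma normal_part_tangent: "p \<in> M \<Longrightarrow> x \<in> T p \<Longrightarrow> normal_part M p v \<bullet> x = 0"
  unfolding normal_part_def by (simp add: inner_diff_left inner_proj subT)

text \<open>As for \<open>laplacian_Basis\<close>, the purpose is smoothness in \<open>p\<close>.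
  The linear map \<open>L\<close> collects the two projections, so that bilinearity of the second
  fundamental form reduces to that of \<open>der M (ext M y) p x\<close>.\<close>

lemma mean_curvature_vector_Basis:
  assumes p: "p \<in> M"
  shows "H p = (1 / real m) *\<^sub>R (\<Sum>b\<in>Basis. normal_part M p (cov (sphere 0 1) M (ext M b) p (ext M b p)))"
proof -
  define L where "L w = normal_part M p (w - (w \<bullet> p) *\<^sub>R p)" for w
  have L: "linear L"
    unfolding L_def normal_part_def
    by (intro linear_compose_sub linear_compose[OF _ linear_proj[OF subT[OF p]], unfolded o_def])
      (auto intro!: linearI simp: algebra_simps inner_add_left)
  have eq: "second_fundamental_field (sphere 0 1) M (ext M x) (ext M y) p = L (der M (ext M y) p (ext M x p))" for x y
    unfolding second_fundamental_field_def L_def cov_M[OF p] ..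
  have LD: "linear (\<lambda>x. L (der M (ext M y) p x))" for y
    using linear_compose[OF linear_der[OF smooth_along_ext[OF M] p] L] by (simp add: o_def)
  have "trace_on (T p) (\<lambda>x y. L (der M (ext M y) p (ext M x p)))
    = (\<Sum>b\<in>Basis. L (der M (ext M b) p (ext M (proj (T p) b) p)))"
  proof (rule trace_on_eq_sum_Basis[OF subT[OF p]])
    fix x y x' c assume x: "x \<in> T p" "x' \<in> T p"
    then have "x + c *\<^sub>R x' \<in> T p" using subT[OF p] by (intro subspace_add subspace_scale)
    then show "L (der M (ext M y) p (ext M (x + c *\<^sub>R x') p)) = L (der M (ext M y) p (ext M x p)) + c *\<^sub>R L (der M (ext M y) p (ext M x' p))"
      using linear_add[OF LD[of y], of x "c *\<^sub>R x'"] linear_cmul[OF LD[of y], of c x'] x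
      by (simp add: ext_tangent[OF M p])
  next
    fix x assume x: "x \<in> T p"
    show "linear (\<lambda>y. L (der M (ext M y) p (ext M x p)))"
      unfolding ext_tangent[OF M p x]
      using linear_compose[OF der_ext_linear[OF M p x] L] by (simp add: o_def)
  qed
  moreover have "ext M (proj (T p) b) p = ext M b p" for b
    unfolding ext_def by (rule proj_id[OF subT[OF p] proj_in[OF subT[OF p]]])
  ultimately show ?thesis
    unfolding mean_curvature_vector_def eq by (simp add: L_def cov_M[OF p])
qed

lemma smooth_along_mean_curvature_vector: "smooth_along M H"
proof (rule smooth_along_cong)
  let ?D = "\<lambda>b p. der M (ext M b) p (ext M b p)"
  let ?C = "\<lambda>b p. ?D b p - (?D b p \<bullet> p) *\<^sub>R p"
  show "smooth_along M (\<lambda>p. (1 / real m) *\<^sub>R (\<Sum>b\<in>Basis. ?C b p - proj (T p) (?C b p)))"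
    by (intro smooth_along_bounded_linear[OF bounded_linear_scaleR_right] smooth_along_sum smooth_along_diff
        smooth_along_proj[OF M] smooth_along_scaleR smooth_along_inner smooth_along_ident
        smooth_along_der_ext[OF M] smooth_along_ext[OF M])
qed (simp add: mean_curvature_vector_Basis normal_part_def cov_M)

text \<open>The covariant derivative has no radial part, and subtracting a tangential part creates
  none, because tangent vectors of \<open>M\<close> are orthogonal to \<open>p\<close>.\<close>

lemma mean_curvature_vector_normal:
  assumes p: "p \<in> M"
  shows "x \<in> T p \<Longrightarrow> H p \<bullet> x = 0" and "H p \<bullet> p = 0"
proof -
  show "H p \<bullet> x = 0" if "x \<in> T p"
    by (simp add: mean_curvature_vector_Basis p inner_sum_left normal_part_tangent that)
  have pp: "p \<bullet> p = 1" using p sphere by (auto simp: dot_square_norm)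
  have "normal_part M p (cov (sphere 0 1) M V p v) \<bullet> p = 0" for V v
    unfolding normal_part_def cov_M[OF p]
    using tangent_radial[OF p proj_in[OF subT[OF p]]] pp by (simp add: inner_diff_left)
  then show "H p \<bullet> p = 0"
    by (simp add: mean_curvature_vector_Basis p inner_sum_left)
qed

section \<open>Consequences of a parallel unit mean curvature vector\<close>

context
  assumes PNMC: "PNMC (sphere 0 1) m M"
begin

private lemma f_pos: "p \<in> M \<Longrightarrow> f p > 0"
  using PNMC unfolding PNMC_def by blast

private lemma H_nonzero: "p \<in> M \<Longrightarrow> H p \<noteq> 0"
  using f_pos unfolding mean_curvature_def by force

private lemma H_eq: "p \<in> M \<Longrightarrow> H p = f p *\<^sub>R \<xi> p"
  using f_pos[of p] unfolding unit_mean_curvature_vector_def by simp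

lemma smooth_along_mean_curvature: "smooth_along M f"
  unfolding mean_curvature_def
  by (rule smooth_along_norm[OF smooth_along_mean_curvature_vector H_nonzero])

lemma smooth_along_unit_mean_curvature_vector: "smooth_along M \<xi>"
  unfolding unit_mean_curvature_vector_def
  by (intro smooth_along_scaleR smooth_along_inverse smooth_along_mean_curvature smooth_along_mean_curvature_vector)
    (metis f_pos less_irrefl)

private lemmas smf = smooth_along_mean_curvature
  and sm\<xi> = smooth_along_unit_mean_curvature_vector
  and smH = smooth_along_mean_curvature_vector

private lemma
  assumes p: "p \<in> M"
  shows \<xi>_tangent: "x \<in> T p \<Longrightarrow> \<xi> p \<bullet> x = 0" and \<xi>_radial: "\<xi> p \<bullet> p = 0" and \<xi>_unit: "\<xi> p \<bullet> \<xi> p = 1"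
  using mean_curvature_vector_normal[OF p] f_pos[OF p]
  by (auto simp: unit_mean_curvature_vector_def mean_curvature_def dot_square_norm power2_eq_square)

text \<open>Differentiating \<open>V q \<bullet> q = 0\<close> leaves
  \<open>- V p \<bullet> x\<close>, which is zero. For such fields the Euclidean derivative is
  already tangent to the sphere, and \<open>cov\<close> can be replaced by
  \<open>der\<close>.\<close>

private lemma der_normal_radial:
  assumes p: "p \<in> M" and x: "x \<in> T p" and V: "smooth_along M V" "\<And>q. q \<in> M \<Longrightarrow> V q \<bullet> q = 0" "V p \<bullet> x = 0"
  shows "der M V p x \<bullet> p = 0"
proof -
  have "der M (\<lambda>q. V q \<bullet> q) p = der M (\<lambda>q. 0) p" by (rule der_cong[OF p]) (rule V(2))
  then show ?thesis
    using der_inner[OF p x V(1) smooth_along_ident] by (simp add: V(3) der_const[OF x] der_ident[OF x])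
qed

private lemma cov_\<xi>: "p \<in> M \<Longrightarrow> x \<in> T p \<Longrightarrow> cov (sphere 0 1) M \<xi> p x = der M \<xi> p x"
  using der_normal_radial[OF _ _ sm\<xi> \<xi>_radial \<xi>_tangent] by (simp add: cov_M)

private lemma cov_H: "p \<in> M \<Longrightarrow> x \<in> T p \<Longrightarrow> cov (sphere 0 1) M H p x = der M H p x"
  using der_normal_radial[OF _ _ smH mean_curvature_vector_normal(2) mean_curvature_vector_normal(1)]
  by (simp add: cov_M)

text \<open>The normal part of the covariant derivative is zero by the PNMC condition, so the
  Euclidean derivative of \<open>\<xi>\<close> is exactly minus the Weingarten operator.\<close>

private lemma der_\<xi>_tangent:
  assumes p: "p \<in> M" and x: "x \<in> T p"
  shows "der M \<xi> p x \<in> T p"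
proof -
  have "normal_cov (sphere 0 1) M \<xi> p x = 0" using PNMC p x unfolding PNMC_def by blast
  then have "der M \<xi> p x = proj (T p) (der M \<xi> p x)"
    unfolding normal_cov_def normal_part_def cov_\<xi>[OF p x] by simp
  then show ?thesis using proj_in[OF subT[OF p]] by metis
qed

text \<open>This product rule is also the splitting into tangential part, the term with the
  derivative of \<open>\<xi>\<close>, and normal part, the term with the derivative of
  \<open>f\<close>.\<close>

private lemma der_H:
  assumes p: "p \<in> M" and x: "x \<in> T p"
  shows "der M H p x = f p *\<^sub>R der M \<xi> p x + der M f p x *\<^sub>R \<xi> p"
proof -
  have "der M H p = der M (\<lambda>q. f q *\<^sub>R \<xi> q) p" by (rule der_cong[OF p]) (rule H_eq)
  then show ?thesis by (simp add: der_scaleR[OF p x smf sm\<xi>])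
qed

private lemma norm_A_eq:
  assumes p: "p \<in> M"
  shows "(norm_A (sphere 0 1) m M p)\<^sup>2 = (\<Sum>e\<in>onb (T p). der M \<xi> p e \<bullet> der M \<xi> p e)"
proof -
  have "trace_on (T p) (\<lambda>x y. weingarten (sphere 0 1) M \<xi> p x \<bullet> weingarten (sphere 0 1) M \<xi> p y)
    = (\<Sum>e\<in>onb (T p). der M \<xi> p e \<bullet> der M \<xi> p e)"
    unfolding trace_on_onb
  proof (rule sum.cong[OF refl])
    fix e assume "e \<in> onb (T p)"
    then have e: "e \<in> T p" by (rule onb_tangent[OF M p])
    have "weingarten (sphere 0 1) M \<xi> p e = - der M \<xi> p e"
      unfolding weingarten_def cov_\<xi>[OF p e] proj_id[OF subT[OF p] der_\<xi>_tangent[OF p e]] ..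
    then show "weingarten (sphere 0 1) M \<xi> p e \<bullet> weingarten (sphere 0 1) M \<xi> p e = der M \<xi> p e \<bullet> der M \<xi> p e"
      by simp
  qed
  then show ?thesis
    unfolding norm_A_def hs_norm_def by (simp add: sum_nonneg)
qed

text \<open>Pairing the first derivative of \<open>H\<close> with \<open>\<xi>\<close> leaves the
  derivative of \<open>f\<close>. Differentiating that pairing once more produces the correction
  \<open>der M H p e \<bullet> der M \<xi> p e\<close>, and only the tangential part of the
  derivative of \<open>H\<close> survives in it.\<close>

private lemma second_cov_H:
  assumes p: "p \<in> M" and e: "e \<in> T p"
  shows "second_cov_field (sphere 0 1) M H (ext M e) (ext M e) p \<bullet> \<xi> p =
    der M (\<lambda>q. der M f q (ext M e q)) p e - der M f p (cov M M (ext M e) p e)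
      - f p * (der M \<xi> p e \<bullet> der M \<xi> p e)"
proof -
  let ?G = "\<lambda>q. der M H q (ext M e q)"
  note ep = ext_tangent[OF M p e] and extT = ext_in_tangent_space[OF M]
  have smG: "smooth_along M ?G" by (rule smooth_along_der_ext[OF M smH])
  have "der M (\<lambda>q. cov (sphere 0 1) M H q (ext M e q)) p = der M ?G p"
    by (rule der_cong[OF p]) (rule cov_H[OF _ extT])
  \<comment> \<open>Projecting to the sphere removes a multiple of \<open>p\<close>, which
    \<open>\<xi> p\<close> does not see.\<close>
  then have 1: "cov (sphere 0 1) M (\<lambda>q. cov (sphere 0 1) M H q (ext M e q)) p e \<bullet> \<xi> p = der M ?G p e \<bullet> \<xi> p"
    by (simp add: cov_M[OF p] inner_diff_left inner_commute[of p "\<xi> p"] \<xi>_radial[OF p])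
  have H\<xi>: "der M H q x \<bullet> \<xi> q = der M f q x" if "q \<in> M" "x \<in> T q" for q x
    by (simp add: der_H[OF that] inner_add_left \<xi>_unit[OF that(1)]
        \<xi>_tangent[OF that(1) der_\<xi>_tangent[OF that], unfolded inner_commute[of "\<xi> q"]])
  have "der M (\<lambda>q. ?G q \<bullet> \<xi> q) p = der M (\<lambda>q. der M f q (ext M e q)) p"
    by (rule der_cong[OF p]) (rule H\<xi>[OF _ extT])
  then have "der M (\<lambda>q. der M f q (ext M e q)) p e = der M H p e \<bullet> der M \<xi> p e + der M ?G p e \<bullet> \<xi> p"
    using der_inner[OF p e smG sm\<xi>] by (simp add: ep)
  moreover have "der M H p e \<bullet> der M \<xi> p e = f p * (der M \<xi> p e \<bullet> der M \<xi> p e)"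
    by (simp add: der_H[OF p e] inner_add_left \<xi>_tangent[OF p der_\<xi>_tangent[OF p e]])
  moreover have "cov (sphere 0 1) M H p (cov M M (ext M e) p e) \<bullet> \<xi> p = der M f p (cov M M (ext M e) p e)"
    unfolding cov_def[of M] by (simp add: cov_H H\<xi> p proj_in[OF subT[OF p]])
  ultimately show ?thesis
    unfolding second_cov_field_def by (simp add: ep inner_diff_left 1)
qed

text \<open>On the unit sphere \<open>R(e, H) e = - H\<close> for a unit tangent vector
  \<open>e\<close> of \<open>M\<close>, since \<open>H\<close> is normal; the \<open>m\<close>
  vectors of the basis together contribute \<open>- m f\<close>. The sign in
  \<open>rough_laplacian\<close> turns \<open>second_cov_H\<close> into the remaining terms.\<close>

lemma laplacian_mean_curvature:
  assumes "biharmonic (sphere 0 1) m M" and p: "p \<in> M"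
  shows "laplacian M f p = f p * ((norm_A (sphere 0 1) m M p)\<^sup>2 - real m)"
proof -
  let ?E = "onb (T p)"
  have "curvature (sphere 0 1) p e (H p) e \<bullet> \<xi> p = - f p" if "e \<in> ?E" for e
  proof -
    have e: "e \<in> T p" by (rule onb_tangent[OF M p that])
    have "e \<bullet> e = 1" using norm_onb[OF subT[OF p] that] by (simp add: dot_square_norm)
    moreover have "p \<in> sphere 0 1" using p sphere by blast
    moreover have "e \<bullet> H p = 0" using mean_curvature_vector_normal(1)[OF p e] by (simp add: inner_commute)
    ultimately have "curvature (sphere 0 1) p e (H p) e = - H p"
      using curvature_sphere[of p e "H p" e] tangent_radial[OF p e] mean_curvature_vector_normal(2)[OF p] by simp
    then show ?thesis using H_eq[OF p] \<xi>_unit[OF p] by simp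
  qed
  then have "trace_on (T p) (\<lambda>x y. curvature (sphere 0 1) p x (H p) y) \<bullet> \<xi> p = - (real m * f p)"
    unfolding trace_on_onb inner_sum_left
    by (simp add: card_onb[OF subT[OF p]] dim_tangent_space[OF M p])
  moreover have "rough_laplacian (sphere 0 1) M H p \<bullet> \<xi> p
    = - (laplacian M f p - f p * (norm_A (sphere 0 1) m M p)\<^sup>2)"
    unfolding rough_laplacian_def trace_on_onb laplacian_onb[OF M p] norm_A_eq[OF p]
    by (simp add: inner_sum_left second_cov_H[OF p onb_tangent[OF M p]] sum_subtractf sum_distrib_left)
  moreover have "rough_laplacian (sphere 0 1) M H p + trace_on (T p) (\<lambda>x y. curvature (sphere 0 1) p x (H p) y) = 0"
    using assms unfolding biharmonic_def Let_def by blast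
  then have "rough_laplacian (sphere 0 1) M H p \<bullet> \<xi> p + trace_on (T p) (\<lambda>x y. curvature (sphere 0 1) p x (H p) y) \<bullet> \<xi> p = 0"
    by (simp flip: inner_add_left)
  ultimately show ?thesis by (simp add: algebra_simps)
qed

text \<open>With \<open>f\<close> constant, \<open>der_H\<close> retains only its tangential
  term.\<close>

lemma PMC_of_mean_curvature_constant:
  assumes "f constant_on M"
  shows "PMC (sphere 0 1) m M"
  unfolding PMC_def
proof (intro ballI)
  fix p x assume p: "p \<in> M" and x: "x \<in> T p"
  obtain c where "\<And>q. q \<in> M \<Longrightarrow> f q = c" using assms unfolding constant_on_def by blast
  then have "der M f p = der M (\<lambda>q. c) p" by (rule der_cong[OF p])
  then have "der M f p x = 0" by (simp add: der_const[OF x])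
  then have "der M H p x \<in> T p"
    by (simp add: der_H[OF p x] subspace_scale[OF subT[OF p]] der_\<xi>_tangent[OF p x])
  then show "normal_cov (sphere 0 1) M H p x = 0"
    unfolding normal_cov_def normal_part_def cov_H[OF p x] by (simp add: proj_id[OF subT[OF p]])
qed

lemma norm_A_of_mean_curvature_constant:
  assumes "f constant_on M" "biharmonic (sphere 0 1) m M" and p: "p \<in> M"
  shows "(norm_A (sphere 0 1) m M p)\<^sup>2 = real m"
proof -
  obtain c where c: "\<And>q. q \<in> M \<Longrightarrow> f q = c" using assms unfolding constant_on_def by blast
  have 0: "der M f q x = 0" if "q \<in> M" "x \<in> T q" for q x
    by (subst der_cong[OF that(1) c]) (simp_all add: der_const[OF that(2)])
  have 1: "der M (\<lambda>q. der M f q (ext M e q)) p x = 0" if "x \<in> T p" for e x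
    by (subst der_cong[OF p 0[OF _ ext_in_tangent_space[OF M]]]) (simp_all add: der_const[OF that])
  have "laplacian M f p = 0"
    unfolding laplacian_onb[OF M p] cov_def
    by (intro sum.neutral) (simp add: 0[OF p] 1 onb_tangent[OF M p] proj_in[OF subT[OF p]])
  then show ?thesis using laplacian_mean_curvature[OF assms(2) p] f_pos[OF p] by simp
qed

end

end

theorem corollary3p2:
  fixes M :: "'a::euclidean_space set" and m n :: nat
  assumes "DIM('a) = n + 1"
    and "submanifold m M" and "connected M" and "compact M" and "M \<subseteq> sphere 0 1"
    and "PNMC (sphere 0 1) m M" and "biharmonic (sphere 0 1) m M"
  shows
    "((\<forall>p\<in>M. (norm_A (sphere 0 1) m M p)\<^sup>2 \<le> real m) \<or>
      (\<forall>p\<in>M. (norm_A (sphere 0 1) m M p)\<^sup>2 \<ge> real m)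
        \<longrightarrow> PMC (sphere 0 1) m M \<and> (\<forall>p\<in>M. (norm_A (sphere 0 1) m M p)\<^sup>2 = real m)) \<and>
     (norm_A (sphere 0 1) m M constant_on M
        \<longrightarrow> PMC (sphere 0 1) m M \<and> (\<forall>p\<in>M. (norm_A (sphere 0 1) m M p)\<^sup>2 = real m))"
proof -
  let ?A = "\<lambda>p. (norm_A (sphere 0 1) m M p)\<^sup>2" and ?f = "mean_curvature (sphere 0 1) m M"
  note M = assms(2) and geom = assms(2,5,6)
  note smf = smooth_along_mean_curvature[OF geom]
  have f: "?f p > 0" if "p \<in> M" for p using assms(6) that unfolding PNMC_def by blast
  note lap = laplacian_mean_curvature[OF geom assms(7)]
  have i: "PMC (sphere 0 1) m M \<and> (\<forall>p\<in>M. ?A p = real m)"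
    if "(\<forall>p\<in>M. ?A p \<le> real m) \<or> (\<forall>p\<in>M. ?A p \<ge> real m)"
  proof -
    have "?f constant_on M" using that
    proof
      assume A: "\<forall>p\<in>M. ?A p \<le> real m"
      show ?thesis
      proof (rule superharmonic_constant_on[OF M assms(3,4) smf])
        fix p assume "p \<in> M"
        then show "laplacian M ?f p \<le> 0" using A f[of p] by (simp add: lap mult_nonneg_nonpos)
      qed
    next
      assume A: "\<forall>p\<in>M. ?A p \<ge> real m"
      \<comment> \<open>The negative of \<open>?f\<close> is written as \<open>0 + (-1) * ?f\<close>
        to fit \<open>laplacian_add_cmul\<close>.\<close>
      have lap': "laplacian M (\<lambda>q. 0 + (-1) * ?f q) p = laplacian M (\<lambda>q. 0) p + (-1) * laplacian M ?f p" if "p \<in> M" for p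
        by (rule laplacian_add_cmul[OF M that smooth_along_const smf])
      \<comment> \<open>Linearity with both functions zero and \<open>c = 1\<close> says that this
        value is twice itself.\<close>
      have "laplacian M (\<lambda>q. 0) p = 0" if "p \<in> M" for p
        using laplacian_add_cmul[OF M that smooth_along_const smooth_along_const, of 0 1 0] by simp
      with lap' have "laplacian M (\<lambda>q. - ?f q) p \<le> 0" if "p \<in> M" for p
        using A f[OF that] that by (simp add: lap)
      then have "(\<lambda>q. - ?f q) constant_on M"
        by (rule superharmonic_constant_on[OF M assms(3,4) smooth_along_minus[OF smf]])
      then show ?thesis unfolding constant_on_def by (metis minus_minus)
    qed
    then show ?thesis
      using PMC_of_mean_curvature_constant[OF geom] norm_A_of_mean_curvature_constant[OF geom _ assms(7)] by blast
  qed
  moreover have "(\<forall>p\<in>M. ?A p \<le> real m) \<or> (\<forall>p\<in>M. ?A p \<ge> real m)" if "norm_A (sphere 0 1) m M constant_on M"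
    using that unfolding constant_on_def by (metis linear)
  ultimately show ?thesis by blast
qed

end
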